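(* Let $\psi:\mathbb{N}\to\mathbb{N}$ be a function with $\psi(n)/n\to\infty$ as $n\to\infty$, and let $$E(\psi)=\Big\{x\in[0,1):\ \lim_{n\to\infty}\frac{\log a_1(x)+\cdots+\log a_n(x)}{\psi(n)}=1\Big\}.$$ If $\psi$ is equivalent to an increasing function, then $E(\psi)\neq\emptyset$ and $$\dim_H E(\psi)=\frac{1}{1+b},\qquad\text{where } b=\limsup_{n\to\infty}\frac{\psi(n+1)}{\psi(n)}.$$ Otherwise (if $\psi$ is not equivalent to any increasing function), $E(\psi)=\emptyset$.
   Context: $\mathbb{N}=\{1,2,3,\dots\}$. The Gauss transformation $T:[0,1)\to[0,1)$ is $T(0)=0$, $T(x)=1/x \pmod 1$ for $x\in(0,1)$. For irrational $x\in[0,1)$, the partial quotients of $x$ are $a_1(x)=\lfloor 1/x\rfloor$ and $a_n(x)=a_1(T^{n-1}(x))$ for $n\ge 2$, so that $x=[a_1(x),a_2(x),\dots]$ is the infinite continued fraction expansion of $x$; in the definition of $E(\psi)$ only points $x$ having an infinite expansion (irrational $x$) are considered. Two functions $\psi,\tilde\psi$ defined on $\mathbb{N}$ are called equivalent if $\psi(n)/\tilde\psi(n)\to1$ as $n\to\infty$. "Increasing" means non-decreasing (in the weak sense). $\dim_H$ denotes Hausdorff dimension. If $b=\infty$, then $1/(1+b)$ is read as $0$. *)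

theory Defs
  imports "HOL-Analysis.Analysis"
begin

definition gauss_map :: "real \<Rightarrow> real" where
  "gauss_map x = (if x = 0 then 0 else frac (1 / x))"

(* Indexed from n = 1; the value at n = 0 is meaningless and never used. *)
definition partial_quotient :: "nat \<Rightarrow> real \<Rightarrow> int" where
  "partial_quotient n x = \<lfloor>1 / (gauss_map ^^ (n - 1)) x\<rfloor>"

definition E_set :: "(nat \<Rightarrow> nat) \<Rightarrow> real set" where
  "E_set \<psi> = {x \<in> {0..<1}. x \<notin> \<rat> \<and>
     (\<lambda>n. (\<Sum>k=1..n. ln (real_of_int (partial_quotient k x))) / real (\<psi> n)) \<longlonglongrightarrow> 1}"

(* The limit 1 forces g n \<noteq> 0 eventually, since f n / 0 = 0. *)
definition equivalent_seq :: "(nat \<Rightarrow> real) \<Rightarrow> (nat \<Rightarrow> real) \<Rightarrow> bool" where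
  "equivalent_seq f g \<longleftrightarrow> (\<lambda>n. f n / g n) \<longlonglongrightarrow> 1"

(* Functions on {1, 2, ...}, so nothing is required of g 0. *)
definition equivalent_to_increasing :: "(nat \<Rightarrow> real) \<Rightarrow> bool" where
  "equivalent_to_increasing f \<longleftrightarrow> (\<exists>g. mono_on {1..} g \<and> equivalent_seq f g)"

(* Separate cases because 0 powr 0 = 0: for s = 0 every nonempty set,
   singletons included, has to count 1 (so that the 0-dimensional measure is counting measure). *)
definition diameter_power :: "real \<Rightarrow> 'a::metric_space set \<Rightarrow> ennreal" where
  "diameter_power s U =
     (if U = {} then 0 else if s = 0 then 1 else ennreal (diameter U powr s))"

(* Boundedness is explicit because diameter is unspecified on unbounded sets.
   Finite covers are included, by padding with empty sets. *)
definition hausdorff_content :: "real \<Rightarrow> real \<Rightarrow> 'a::metric_space set \<Rightarrow> ennreal" where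
  "hausdorff_content s \<delta> A =
     (INF U \<in> {U :: nat \<Rightarrow> 'a set. A \<subseteq> (\<Union>i. U i) \<and>
                 (\<forall>i. bounded (U i) \<and> diameter (U i) \<le> \<delta>)}.
        \<Sum>i. diameter_power s (U i))"

definition hausdorff_measure :: "real \<Rightarrow> 'a::metric_space set \<Rightarrow> ennreal" where
  "hausdorff_measure s A = (SUP \<delta> \<in> {0<..}. hausdorff_content s \<delta> A)"

definition hausdorff_dim :: "'a::metric_space set \<Rightarrow> ennreal" where
  "hausdorff_dim A = (INF s \<in> {s. 0 \<le> s \<and> hausdorff_measure s A = 0}. ennreal s)"

end

theory Submission
  imports Defs
begin

text \<open>
  Write \<open>S\<^sub>n(x)\<close> for the sum of the logarithms of the first \<open>n\<close> partial quotients of \<open>x\<close>, and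
  \<open>x\<^sub>n\<close> for the \<open>n\<close>-th iterate of \<open>x\<close> under the Gauss map. Along an orbit \<open>S\<^sub>n(x)\<close> is non-decreasing
  because partial quotients are at least \<open>1\<close>, so a point of \<open>E(\<psi>)\<close> exhibits an increasing function
  equivalent to \<open>\<psi>\<close>; this settles the case in which there is none.

  The dimension rests on the recursion \<open>x\<^sub>k = 1 / (a\<^sub>k\<^sub>+\<^sub>1 + x\<^sub>k\<^sub>+\<^sub>1)\<close> alone, in place of
  the usual estimates for the denominators of convergents. If \<open>x\<close> and \<open>y\<close> share their first \<open>n\<close>
  partial quotients, then \<open>|x - y|\<close> lies between \<open>|x\<^sub>n - y\<^sub>n|\<close> divided by the product of the
  \<open>(a\<^sub>k + 1)\<^sup>2\<close> and by the product of the \<open>a\<^sub>k\<^sup>2\<close> (\<open>tails_distance\<close>). A factor exponential in \<open>n\<close>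
  is harmless, because \<open>n\<close> is negligible against \<open>\<psi>(n)\<close>.

  Upper bound, with closeness understood for logarithms up to a factor \<open>1 + \<epsilon>\<close>. Points of \<open>E(\<psi>)\<close>
  have, for all large \<open>n\<close>, a product \<open>P\<close> of the first \<open>n\<close> quotients close to \<open>exp \<psi>(n)\<close>, and then \<open>a\<^sub>n\<^sub>+\<^sub>1\<close> close to \<open>exp (\<psi>(n+1)) / P\<close>. Those with prescribed
  first \<open>n\<close> quotients lie in a set of diameter about \<open>1 / (P exp \<psi>(n+1))\<close>, and there are about
  \<open>exp \<psi>(n)\<close> choices of the quotients, so the sum of the \<open>s\<close>-th powers of the diameters is about
  \<open>exp (\<psi>(n) - s (\<psi>(n) + \<psi>(n+1)))\<close>. When \<open>s > 1/(1+b)\<close> this is small for infinitely many \<open>n\<close>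
  (\<open>hausdorff_content_large_quotient\<close>, \<open>hausdorff_dim_E_set_le\<close>).

  Lower bound. Take an increasing \<open>g\<close> equivalent to \<open>\<psi>\<close> and integers \<open>r\<^sub>k \<ge> 2\<close> within a
  constant factor of \<open>exp (g(k+1) - g(k))\<close>. Letting \<open>a\<^sub>k\<^sub>+\<^sub>1\<close> range over \<open>{r\<^sub>k ..< 2 r\<^sub>k}\<close> gives points
  of \<open>E(\<psi>)\<close>. The offsets \<open>a\<^sub>k\<^sub>+\<^sub>1 - r\<^sub>k\<close> are free digits below \<open>r\<^sub>k\<close>, so these points are
  parametrized by \<open>t \<in> [0,1)\<close> through the expansion of \<open>t\<close> with the radices \<open>r\<^sub>k\<close>
  (\<open>E_set_Cantor_parametrization\<close>). For \<open>s < 1/(1+b)\<close> the inverse of the parametrization is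
  \<open>s\<close>-Hoelder (\<open>cf_radix_hoelder\<close>). Hence a cover of \<open>E(\<psi>)\<close> with small \<open>s\<close>-sum would give a cover
  of \<open>[0,1)\<close> by intervals of small total length (\<open>hausdorff_measure_neq_0_if_expanding\<close>). The same
  points show that \<open>E(\<psi>)\<close> is nonempty, also when \<open>b = \<infinity>\<close>.
\<close>

section \<open>Hausdorff content and measure\<close>

lemma hausdorff_content_finite_cover:
  assumes "finite W" "A \<subseteq> (\<Union>w\<in>W. U w)"
    and "\<And>w. w \<in> W \<Longrightarrow> bounded (U w) \<and> diameter (U w) \<le> \<delta>" "0 \<le> \<delta>"
  shows "hausdorff_content s \<delta> A \<le> (\<Sum>w\<in>W. diameter_power s (U w))"
proof -
  obtain e where e: "bij_betw e {..<card W} W"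
    using ex_bij_betw_nat_finite[OF assms(1)] by (auto simp: atLeast0LessThan)
  define V where "V i = (if i < card W then U (e i) else {})" for i
  have eW: "e i \<in> W" if "i < card W" for i
    using e that by (auto simp: bij_betw_def)
  have "A \<subseteq> (\<Union>i. V i)"
  proof
    fix x assume "x \<in> A"
    then obtain w where w: "w \<in> W" "x \<in> U w" using assms(2) by auto
    then obtain i where "i < card W" "w = e i"
      using e by (auto simp: bij_betw_def)
    then have "x \<in> V i" using w by (simp add: V_def)
    then show "x \<in> (\<Union>i. V i)" by blast
  qed
  moreover have "bounded (V i) \<and> diameter (V i) \<le> \<delta>" for i
    using assms(3)[OF eW] assms(4) by (auto simp: V_def)
  ultimately have "hausdorff_content s \<delta> A \<le> (\<Sum>i. diameter_power s (V i))"
    unfolding hausdorff_content_def by (intro INF_lower) auto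
  also have "\<dots> = (\<Sum>i<card W. diameter_power s (V i))"
    by (intro suminf_finite) (auto simp: V_def diameter_power_def)
  also have "\<dots> = (\<Sum>i<card W. diameter_power s (U (e i)))"
    by (intro sum.cong) (auto simp: V_def)
  also have "\<dots> = (\<Sum>w\<in>W. diameter_power s (U w))"
    by (rule sum.reindex_bij_betw[OF e])
  finally show ?thesis .
qed

text \<open>
  Covers of the \<open>N\<close>-th set with sum below \<open>\<epsilon> / 2\<^sup>N\<^sup>+\<^sup>1\<close> are merged into one sequence by a
  pairing function.
\<close>
lemma hausdorff_content_Union_eq_0:
  fixes A :: "nat \<Rightarrow> 'a::metric_space set"
  assumes "\<And>N. hausdorff_content s \<delta> (A N) = 0"
  shows "hausdorff_content s \<delta> (\<Union>N. A N) = 0"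
proof -
  have "hausdorff_content s \<delta> (\<Union>N. A N) \<le> ennreal \<epsilon>" if "\<epsilon> > 0" for \<epsilon> :: real
  proof -
    have "\<exists>U. A N \<subseteq> (\<Union>i. U i) \<and> (\<forall>i. bounded (U i) \<and> diameter (U i) \<le> \<delta>) \<and>
        (\<Sum>i. diameter_power s (U i)) < ennreal (\<epsilon> * (1/2)^Suc N)" for N
    proof -
      have "hausdorff_content s \<delta> (A N) < ennreal (\<epsilon> * (1/2)^Suc N)"
        using assms that by (simp add: ennreal_zero_less_mult_iff)
      then show ?thesis
        unfolding hausdorff_content_def INF_less_iff by blast
    qed
    then obtain U where U: "\<And>N. A N \<subseteq> (\<Union>i. U N i)"
      "\<And>N i. bounded (U N i) \<and> diameter (U N i) \<le> \<delta>"
      "\<And>N. (\<Sum>i. diameter_power s (U N i)) < ennreal (\<epsilon> * (1/2)^Suc N)"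
      by metis
    define V where "V k = (case prod_decode k of (N, i) \<Rightarrow> U N i)" for k
    have "(\<Union>N. A N) \<subseteq> (\<Union>k. V k)"
    proof
      fix x assume "x \<in> (\<Union>N. A N)"
      then obtain N i where "x \<in> U N i" using U(1) by blast
      then have "x \<in> V (prod_encode (N, i))" by (simp add: V_def)
      then show "x \<in> (\<Union>k. V k)" by blast
    qed
    moreover have "bounded (V k) \<and> diameter (V k) \<le> \<delta>" for k
      using U(2) by (auto simp: V_def split: prod.split)
    ultimately have "hausdorff_content s \<delta> (\<Union>N. A N) \<le> (\<Sum>k. diameter_power s (V k))"
      unfolding hausdorff_content_def by (intro INF_lower) auto
    also have "\<dots> = (\<Sum>k. (\<lambda>(N, i). diameter_power s (U N i)) (prod_decode k))"
      by (intro arg_cong[where f = suminf] ext) (auto simp: V_def split: prod.split)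
    also have "\<dots> = (\<Sum>N. \<Sum>i. diameter_power s (U N i))"
      by (subst suminf_ennreal_2dimen
          [symmetric, of "\<lambda>N. \<Sum>i. diameter_power s (U N i)" "\<lambda>(N, i). diameter_power s (U N i)"])
         (auto simp: comp_def)
    also have "\<dots> \<le> (\<Sum>N. ennreal (\<epsilon> * (1/2)^Suc N))"
      using U(3) by (intro suminf_le) (auto simp: less_imp_le)
    also have "\<dots> = ennreal (\<epsilon> * 1)"
      using that by (intro suminf_ennreal_eq sums_mult power_half_series) auto
    finally show ?thesis by simp
  qed
  then show ?thesis
    by (metis ennreal_le_epsilon add_0 le_zero_eq)
qed

lemma hausdorff_dim_le:
  assumes "0 \<le> s" "\<And>\<delta>. \<delta> > 0 \<Longrightarrow> hausdorff_content s \<delta> A = 0"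
  shows "hausdorff_dim A \<le> ennreal s"
  unfolding hausdorff_dim_def
  by (rule INF_lower) (use assms in \<open>auto simp: hausdorff_measure_def\<close>)

text \<open>
  The exponent \<open>0\<close> is outside the scope of the Hoelder argument that follows.
\<close>
lemma hausdorff_measure_0_neq_0:
  assumes "A \<noteq> {}"
  shows "hausdorff_measure 0 A \<noteq> 0"
proof -
  have "1 \<le> hausdorff_content 0 1 A"
    unfolding hausdorff_content_def
  proof (rule INF_greatest, clarify)
    fix U :: "nat \<Rightarrow> 'a set" assume "A \<subseteq> (\<Union>i. U i)"
    then obtain i where "U i \<noteq> {}" using assms by blast
    then have "1 \<le> (\<Sum>j\<in>{i}. diameter_power 0 (U j))" by (simp add: diameter_power_def)
    also have "\<dots> \<le> (\<Sum>j. diameter_power 0 (U j))"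
      by (rule sum_le_suminf) auto
    finally show "1 \<le> (\<Sum>j. diameter_power 0 (U j))" .
  qed
  also have "\<dots> \<le> hausdorff_measure 0 A"
    unfolding hausdorff_measure_def by (rule SUP_upper) auto
  finally show ?thesis by auto
qed

text \<open>
  A substitute for the mass distribution principle that needs no measure on \<open>A\<close>: pulling a cover
  of \<open>A\<close> back along \<open>\<phi>\<close> gives sets in \<open>[0,1)\<close>, each inside an interval of length at most
  \<open>2 C\<close> times the \<open>s\<close>-th power of the diameter, and Lebesgue measure is subadditive on these
  intervals whatever the measurability of the pulled back sets.
\<close>
lemma hausdorff_measure_neq_0_if_expanding:
  fixes \<phi> :: "real \<Rightarrow> 'a::metric_space"
  assumes "\<And>t. t \<in> {0..<1} \<Longrightarrow> \<phi> t \<in> A" "s > 0" "C > 0"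
    and hoelder: "\<And>t u. t \<in> {0..<1} \<Longrightarrow> u \<in> {0..<1} \<Longrightarrow>
           \<bar>t - u\<bar> \<le> C * dist (\<phi> t) (\<phi> u) powr s"
  shows "hausdorff_measure s A \<noteq> 0"
proof -
  have "ennreal (1 / (2 * C)) \<le> hausdorff_content s 1 A"
    unfolding hausdorff_content_def
  proof (rule INF_greatest, clarify)
    fix U :: "nat \<Rightarrow> 'a set"
    assume cover: "A \<subseteq> (\<Union>i. U i)" and U: "\<forall>i. bounded (U i) \<and> diameter (U i) \<le> 1"
    have "\<exists>I. {t \<in> {0..<1}. \<phi> t \<in> U i} \<subseteq> I \<and> I \<in> sets lborel \<and>
        emeasure lborel I \<le> ennreal (2 * C) * diameter_power s (U i)" for i
    proof (cases "{t \<in> {0..<1}. \<phi> t \<in> U i} = {}")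
      case True
      then show ?thesis by (intro exI[of _ "{}"]) auto
    next
      case False
      then obtain t where t: "t \<in> {0..<1}" "\<phi> t \<in> U i" by blast
      define r where "r = C * diameter (U i) powr s"
      have "\<bar>t - u\<bar> \<le> r" if "u \<in> {0..<1}" "\<phi> u \<in> U i" for u
      proof -
        have "dist (\<phi> t) (\<phi> u) \<le> diameter (U i)"
          using t that U by (intro diameter_bounded_bound) auto
        then have "C * dist (\<phi> t) (\<phi> u) powr s \<le> r"
          unfolding r_def using assms(2,3) by (intro mult_left_mono powr_mono2) auto
        then show ?thesis using hoelder[OF t(1) that(1)] by linarith
      qed
      moreover have "r \<ge> 0" using assms(3) by (simp add: r_def)
      moreover have "ennreal (2 * r) = ennreal (2 * C) * diameter_power s (U i)"
        using t assms(2,3) by (auto simp: r_def diameter_power_def ennreal_mult'[symmetric] mult.assoc)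
      ultimately show ?thesis
        by (intro exI[of _ "{t - r..t + r}"]) (force simp: abs_le_iff)
    qed
    then obtain I where I: "\<And>i. {t \<in> {0..<1}. \<phi> t \<in> U i} \<subseteq> I i" "\<And>i. I i \<in> sets lborel"
      "\<And>i. emeasure lborel (I i) \<le> ennreal (2 * C) * diameter_power s (U i)"
      by metis
    have "{0..<1::real} \<subseteq> (\<Union>i. I i)"
    proof
      fix t :: real assume t: "t \<in> {0..<1}"
      then obtain i where "\<phi> t \<in> U i" using assms(1) cover by blast
      then show "t \<in> (\<Union>i. I i)" using I(1)[of i] t by blast
    qed
    then have "emeasure lborel {0..<1::real} \<le> emeasure lborel (\<Union>i. I i)"
      using I(2) by (intro emeasure_mono) auto
    also have "\<dots> \<le> (\<Sum>i. emeasure lborel (I i))"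
      using I(2) by (intro emeasure_subadditive_countably) auto
    also have "\<dots> \<le> (\<Sum>i. ennreal (2 * C) * diameter_power s (U i))"
      using I(3) by (intro suminf_le) auto
    also have "\<dots> = ennreal (2 * C) * (\<Sum>i. diameter_power s (U i))"
      by simp
    finally have "1 \<le> ennreal (2 * C) * (\<Sum>i. diameter_power s (U i))" by simp
    then have "ennreal (1 / (2 * C)) * 1 \<le>
        ennreal (1 / (2 * C)) * (ennreal (2 * C) * (\<Sum>i. diameter_power s (U i)))"
      by (intro mult_left_mono) auto
    also have "\<dots> = (\<Sum>i. diameter_power s (U i))"
      using assms(3) by (simp add: mult.assoc[symmetric] ennreal_mult'[symmetric])
    finally show "ennreal (1 / (2 * C)) \<le> (\<Sum>i. diameter_power s (U i))" by simp
  qed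
  also have "\<dots> \<le> hausdorff_measure s A"
    unfolding hausdorff_measure_def by (rule SUP_upper) auto
  finally show ?thesis using assms(3) by (auto simp: ennreal_eq_0_iff)
qed

section \<open>Continued fractions through the tails of the Gauss map\<close>

lemma gauss_map_irrational:
  assumes "0 < x" "x < 1" "x \<notin> \<rat>"
  shows "0 < gauss_map x" "gauss_map x < 1" "gauss_map x \<notin> \<rat>"
    and "x = 1 / (real_of_int \<lfloor>1 / x\<rfloor> + gauss_map x)" "1 \<le> \<lfloor>1 / x\<rfloor>"
proof -
  have g: "gauss_map x = 1 / x - of_int \<lfloor>1 / x\<rfloor>"
    using assms(1) by (simp add: gauss_map_def frac_def)
  have eq: "real_of_int \<lfloor>1 / x\<rfloor> + gauss_map x = 1 / x" using g by simp
  then show "x = 1 / (real_of_int \<lfloor>1 / x\<rfloor> + gauss_map x)" by simp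
  show nr: "gauss_map x \<notin> \<rat>"
  proof
    assume "gauss_map x \<in> \<rat>"
    then have "1 / x \<in> \<rat>" using eq by (metis Rats_add Rats_of_int)
    then have "inverse (1 / x) \<in> \<rat>" by (rule Rats_inverse)
    then show False using assms(3) by simp
  qed
  show "gauss_map x < 1" by (simp add: gauss_map_def frac_lt_1)
  have "0 \<le> gauss_map x" by (simp add: gauss_map_def)
  then show "0 < gauss_map x" using nr by (metis Rats_0 order_le_less)
  show "1 \<le> \<lfloor>1 / x\<rfloor>" using assms by (simp add: le_floor_iff)
qed

lemma gauss_tail_irrational:
  assumes "0 \<le> x" "x < 1" "x \<notin> \<rat>"
  shows "0 < (gauss_map ^^ k) x \<and> (gauss_map ^^ k) x < 1 \<and> (gauss_map ^^ k) x \<notin> \<rat>"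
proof (induction k)
  case 0
  have "x \<noteq> 0" using assms(3) by auto
  then show ?case using assms by auto
next
  case (Suc k)
  then show ?case using gauss_map_irrational by auto
qed

lemma
  assumes "0 \<le> x" "x < 1" "x \<notin> \<rat>"
  shows gauss_tail_step: "(gauss_map ^^ k) x =
      1 / (real_of_int (partial_quotient (Suc k) x) + (gauss_map ^^ Suc k) x)"
    and partial_quotient_ge_1: "1 \<le> partial_quotient (Suc k) x"
  using gauss_map_irrational(4,5)[of "(gauss_map ^^ k) x"] gauss_tail_irrational[OF assms, of k]
  by (auto simp: partial_quotient_def)

text \<open>
  Each step of the recursion divides the distance of the tails by
  \<open>(w\<^sub>k + u\<^sub>k\<^sub>+\<^sub>1) (w\<^sub>k + v\<^sub>k\<^sub>+\<^sub>1)\<close>, which lies between \<open>w\<^sub>k\<^sup>2\<close> and \<open>(w\<^sub>k + 1)\<^sup>2\<close>.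
\<close>
lemma tails_distance:
  fixes u v w :: "nat \<Rightarrow> real"
  assumes "\<And>k. k < n \<Longrightarrow> u k = 1 / (w k + u (Suc k))" "\<And>k. k < n \<Longrightarrow> v k = 1 / (w k + v (Suc k))"
    and "\<And>k. k < n \<Longrightarrow> 1 \<le> w k"
    and "\<And>k. 0 \<le> u k \<and> u k \<le> 1" "\<And>k. 0 \<le> v k \<and> v k \<le> 1"
  shows "\<bar>u n - v n\<bar> / (\<Prod>k<n. (w k + 1)^2) \<le> \<bar>u 0 - v 0\<bar>"
    and "\<bar>u 0 - v 0\<bar> \<le> \<bar>u n - v n\<bar> / (\<Prod>k<n. (w k)^2)"
proof -
  have "\<bar>u n - v n\<bar> / (\<Prod>k<n. (w k + 1)^2) \<le> \<bar>u 0 - v 0\<bar> \<and>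
        \<bar>u 0 - v 0\<bar> \<le> \<bar>u n - v n\<bar> / (\<Prod>k<n. (w k)^2)"
    using assms(1-3)
  proof (induction n)
    case (Suc n)
    have w: "1 \<le> w n" using Suc.prems by simp
    have uv: "0 \<le> u (Suc n)" "u (Suc n) \<le> 1" "0 \<le> v (Suc n)" "v (Suc n) \<le> 1"
      using assms(4,5) by auto
    define D where "D = (w n + u (Suc n)) * (w n + v (Suc n))"
    have D: "(w n)^2 \<le> D" "D \<le> (w n + 1)^2" "0 < D"
      unfolding D_def power2_eq_square using w uv by (auto intro!: mult_mono mult_pos_pos)
    have step: "\<bar>u n - v n\<bar> = \<bar>u (Suc n) - v (Suc n)\<bar> / D"
    proof -
      have "u n - v n = (v (Suc n) - u (Suc n)) / D"
        unfolding Suc.prems(1)[of n, simplified] Suc.prems(2)[of n, simplified] D_def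
        using w uv by (simp add: diff_frac_eq)
      then show ?thesis using D(3) by (simp add: abs_divide abs_minus_commute)
    qed
    have "0 < w k" if "k < n" for k using Suc.prems(3)[of k] that by simp
    then have pos: "0 < (\<Prod>k<n. (w k + 1)^2)" "0 < (\<Prod>k<n. (w k)^2)"
      by (auto intro!: prod_pos zero_less_power add_pos_pos)
    have "\<bar>u (Suc n) - v (Suc n)\<bar> / (w n + 1)^2 \<le> \<bar>u n - v n\<bar>"
      unfolding step using D w by (intro divide_left_mono mult_pos_pos zero_less_power) auto
    moreover have "\<bar>u n - v n\<bar> \<le> \<bar>u (Suc n) - v (Suc n)\<bar> / (w n)^2"
      unfolding step using D w by (intro divide_left_mono) auto
    ultimately have
      "\<bar>u (Suc n) - v (Suc n)\<bar> / (w n + 1)^2 / (\<Prod>k<n. (w k + 1)^2) \<le> \<bar>u n - v n\<bar> / (\<Prod>k<n. (w k + 1)^2)"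
      "\<bar>u n - v n\<bar> / (\<Prod>k<n. (w k)^2) \<le> \<bar>u (Suc n) - v (Suc n)\<bar> / (w n)^2 / (\<Prod>k<n. (w k)^2)"
      using pos by (intro divide_right_mono; simp)+
    moreover have "\<bar>u n - v n\<bar> / (\<Prod>k<n. (w k + 1)^2) \<le> \<bar>u 0 - v 0\<bar> \<and>
        \<bar>u 0 - v 0\<bar> \<le> \<bar>u n - v n\<bar> / (\<Prod>k<n. (w k)^2)"
      using Suc by simp
    ultimately show ?case by (simp add: mult.commute)
  qed simp
  then show "\<bar>u n - v n\<bar> / (\<Prod>k<n. (w k + 1)^2) \<le> \<bar>u 0 - v 0\<bar>"
    and "\<bar>u 0 - v 0\<bar> \<le> \<bar>u n - v n\<bar> / (\<Prod>k<n. (w k)^2)" by auto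
qed

text \<open>
  The tails of the continued fraction with digits \<open>a\<close>, as limits of finite continued fractions.
  Digits at least \<open>2\<close> make every step a contraction by the factor \<open>1/4\<close>, and they keep the tails
  at or below \<open>1/2\<close>, which later separates neighbouring cylinders.
\<close>
lemma cf_tails_exist:
  fixes a :: "nat \<Rightarrow> nat"
  assumes a: "\<And>k. 2 \<le> a k"
  shows "\<exists>X. \<forall>k. 0 < X k \<and> X k \<le> 1/2 \<and> X k = 1 / (real (a k) + X (Suc k))"
proof -
  \<comment> \<open>\<open>c m k\<close> is the finite continued fraction with the \<open>m\<close> digits from position \<open>k\<close> on.\<close>
  define c :: "nat \<Rightarrow> nat \<Rightarrow> real" where
    "c = rec_nat (\<lambda>k. 0) (\<lambda>m f k. 1 / (real (a k) + f (Suc k)))"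
  have c0: "c 0 k = 0" and cS: "c (Suc m) k = 1 / (real (a k) + c m (Suc k))" for m k
    by (simp_all add: c_def)
  have a2: "2 \<le> real (a k)" for k using a[of k] by simp
  have c_nonneg: "0 \<le> c m k" for m k
    by (induction m arbitrary: k) (auto simp: c0 cS)
  have cauchy: "\<bar>c (Suc m) k - c m k\<bar> \<le> (1/4)^m" for m k
  proof (induction m arbitrary: k)
    case 0
    have "1 / real (a k) \<le> 1 / 1" by (rule divide_left_mono) (use a2[of k] in auto)
    then show ?case by (simp add: c0 cS)
  next
    case (Suc m)
    let ?u = "c (Suc m) (Suc k)" and ?v = "c m (Suc k)"
    have D: "4 \<le> (real (a k) + ?u) * (real (a k) + ?v)"
      using mult_mono[of 2 "real (a k) + ?u" 2 "real (a k) + ?v"] a2[of k]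
        c_nonneg[of "Suc m" "Suc k"] c_nonneg[of m "Suc k"] by linarith
    have "c (Suc (Suc m)) k - c (Suc m) k = (?v - ?u) / ((real (a k) + ?u) * (real (a k) + ?v))"
      using a2[of k] c_nonneg[of "Suc m" "Suc k"] c_nonneg[of m "Suc k"]
      by (subst cS[of "Suc m"], subst cS[of m k], simp only: diff_frac_eq) (auto simp: diff_frac_eq)
    then have "\<bar>c (Suc (Suc m)) k - c (Suc m) k\<bar> = \<bar>?u - ?v\<bar> / ((real (a k) + ?u) * (real (a k) + ?v))"
      using D by (simp add: abs_divide abs_minus_commute)
    also have "\<dots> \<le> \<bar>?u - ?v\<bar> / 4"
      using D by (intro divide_left_mono) auto
    also have "\<dots> \<le> (1/4)^m / 4" using Suc[of "Suc k"] by (intro divide_right_mono) auto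
    finally show ?case by simp
  qed
  have conv: "convergent (\<lambda>m. c m k)" for k
  proof -
    have "summable (\<lambda>m. c (Suc m) k - c m k)"
      by (rule summable_comparison_test'[where N = 0 and g = "\<lambda>m. (1/4::real)^m"])
         (use cauchy in auto)
    moreover have "(\<Sum>m<n. c (Suc m) k - c m k) = c n k" for n
      by (induction n) (auto simp: c0)
    ultimately show ?thesis
      unfolding summable_iff_convergent by simp
  qed
  define X where "X k = lim (\<lambda>m. c m k)" for k
  have X: "(\<lambda>m. c m k) \<longlonglongrightarrow> X k" for k
    using conv by (simp add: X_def convergent_LIMSEQ_iff)
  have X_nonneg: "0 \<le> X k" for k
    by (rule LIMSEQ_le_const[OF X]) (use c_nonneg in auto)
  have X_step: "X k = 1 / (real (a k) + X (Suc k))" for k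
  proof (rule LIMSEQ_unique)
    show "(\<lambda>m. c (Suc m) k) \<longlonglongrightarrow> X k" using X[of k] by (rule LIMSEQ_Suc)
    show "(\<lambda>m. c (Suc m) k) \<longlonglongrightarrow> 1 / (real (a k) + X (Suc k))"
      unfolding cS using a2[of k] X_nonneg[of "Suc k"] by (intro tendsto_intros X) auto
  qed
  have "0 < X k \<and> X k \<le> 1/2" for k
  proof -
    have "0 < 1 / (real (a k) + X (Suc k))" "1 / (real (a k) + X (Suc k)) \<le> 1 / 2"
      using a2[of k] X_nonneg[of "Suc k"] by (auto intro!: divide_left_mono divide_pos_pos)
    then show ?thesis by (simp flip: X_step)
  qed
  then show ?thesis using X_step by blast
qed

lemma cf_tails_partial_quotients:
  fixes a :: "nat \<Rightarrow> nat" and X :: "nat \<Rightarrow> real"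
  assumes X01: "\<And>k. 0 < X k \<and> X k < 1" and X_step: "\<And>k. X k = 1 / (real (a k) + X (Suc k))"
  shows "X 0 \<notin> \<rat>" and "partial_quotient (Suc k) (X 0) = int (a k)"
proof -
  have inv: "1 / X k = real (a k) + X (Suc k)" for k
    by (subst X_step) simp
  have fl: "\<lfloor>1 / X k\<rfloor> = int (a k)" for k
    unfolding inv using X01[of "Suc k"] by (intro floor_unique) auto
  have "gauss_map (X k) = X (Suc k)" for k
    using X01[of k] inv[of k] fl[of k] by (simp add: gauss_map_def frac_def)
  then have "(gauss_map ^^ k) (X 0) = X k" for k
    by (induction k) auto
  then show "partial_quotient (Suc k) (X 0) = int (a k)"
    by (simp add: partial_quotient_def fl)
  \<comment> \<open>A tail \<open>p / q\<close> with \<open>0 < p < q\<close> is followed by a tail with denominator \<open>p\<close>: infinite descent.\<close>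
  have descent: "X k \<noteq> real_of_int p / real q" if "q > 0" for k p q
    using that
  proof (induction q arbitrary: k p rule: less_induct)
    case (less q)
    show ?case
    proof
      assume eq: "X k = real_of_int p / real q"
      have p: "0 < p" "p < int q"
        using X01[of k] less.prems unfolding eq by (auto simp: field_simps)
      have "X (Suc k) = real q / real_of_int p - real (a k)"
        using inv[of k] unfolding eq by simp
      also have "\<dots> = real_of_int (int q - int (a k) * p) / real (nat p)"
        using p by (simp add: field_simps)
      finally have "X (Suc k) = real_of_int (int q - int (a k) * p) / real (nat p)" .
      moreover have "nat p < q" "0 < nat p" using p by auto
      ultimately show False
        using less.IH by blast
    qed
  qed
  show "X 0 \<notin> \<rat>"
  proof
    assume "X 0 \<in> \<rat>"
    then obtain p q where "q > 0" "X 0 = real_of_int p / real_of_int q"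
      by (metis Rats_cases')
    then show False using descent[of "nat q" 0 p] by simp
  qed
qed

lemma hausdorff_content_mono:
  assumes "A \<subseteq> B"
  shows "hausdorff_content s \<delta> A \<le> hausdorff_content s \<delta> B"
  unfolding hausdorff_content_def by (rule INF_superset_mono) (use assms in auto)

section \<open>The upper bound for the dimension\<close>

text \<open>
  The sum over words factorizes into single digits. It is used to count words with a bounded product:
  an exponent just above \<open>1\<close> costs only a constant factor per digit.
\<close>
lemma sum_digit_words_le:
  fixes p :: real
  assumes "p > 1"
  shows "(\<Sum>w\<in>PiE {..<n} (\<lambda>_. {1..B}). \<Prod>k<n. real (w k) powr -p)
     \<le> (\<Sum>a. real a powr -p) ^ n"
proof -
  have "(\<Sum>w\<in>PiE {..<n} (\<lambda>_. {1..B}). \<Prod>k<n. real (w k) powr -p)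
      = (\<Prod>k<n. \<Sum>a\<in>{1..B}. real a powr -p)"
    by (rule prod_sum_PiE[symmetric]) auto
  also have "\<dots> = (\<Sum>a\<in>{1..B}. real a powr -p) ^ n" by simp
  also have "\<dots> \<le> (\<Sum>a. real a powr -p) ^ n"
    using assms by (intro power_mono sum_le_suminf sum_nonneg)
      (auto simp: summable_real_powr_iff)
  finally show ?thesis .
qed

text \<open>
  The set is covered by its intersections with the cylinders of order \<open>n\<close>. Two points of one
  cylinder with digit product \<open>P\<close> have \<open>n\<close>-th tails at most \<open>1 / a\<^sub>n\<^sub>+\<^sub>1 \<le> P exp (-L)\<close>, hence
  distance at most \<open>exp (-L) / P\<close>. In the sum over cylinders, the bound \<open>P \<le> exp H\<close> is spent on the
  factor \<open>P powr (p - s)\<close>, and the remaining \<open>P powr (-p)\<close> is summable.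
\<close>
lemma hausdorff_content_large_quotient:
  fixes p s H L \<delta> :: real and n :: nat
  defines "F \<equiv> {x. 0 \<le> x \<and> x < 1 \<and> x \<notin> \<rat> \<and>
      (\<Sum>k<n. ln (real_of_int (partial_quotient (Suc k) x))) \<le> H \<and>
      L \<le> (\<Sum>k<Suc n. ln (real_of_int (partial_quotient (Suc k) x)))}"
  assumes "p > 1" "0 < s" "s \<le> p" "exp (-L) \<le> \<delta>"
  shows "hausdorff_content s \<delta> F \<le>
      ennreal ((\<Sum>a. real a powr -p) ^ n * exp ((p - s) * H - s * L))"
proof -
  \<comment> \<open>Every digit is at most the product of all digits, so finitely many words suffice.\<close>
  define B where "B = nat \<lfloor>exp H\<rfloor>"
  define W where "W = PiE {..<n} (\<lambda>_. {1..B})"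
  define U where "U w = {x \<in> F. \<forall>k<n. partial_quotient (Suc k) x = int (w k)}" for w
  define P where "P w = (\<Prod>k<n. real (w k))" for w :: "nat \<Rightarrow> nat"
  have finW: "finite W" unfolding W_def by (intro finite_PiE) auto
  have F: "0 \<le> x" "x < 1" "x \<notin> \<rat>" if "x \<in> F" for x
    using that by (auto simp: F_def)
  have pq1: "1 \<le> partial_quotient (Suc k) x" if "x \<in> F" for x k
    using partial_quotient_ge_1 F[OF that] by blast
  have w_ge: "1 \<le> w k" if "w \<in> W" "k < n" for w k
    using that by (auto simp: W_def PiE_def Pi_def)
  have P1: "1 \<le> P w" if "w \<in> W" for w
    unfolding P_def using w_ge[OF that] by (intro prod_ge_1) force
  have cover: "F \<subseteq> (\<Union>w\<in>W. U w)"
  proof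
    fix x assume x: "x \<in> F"
    define w where "w = restrict (\<lambda>k. nat (partial_quotient (Suc k) x)) {..<n}"
    have "nat (partial_quotient (Suc k) x) \<in> {1..B}" if "k < n" for k
    proof -
      have "ln (real_of_int (partial_quotient (Suc k) x)) \<le>
          (\<Sum>k<n. ln (real_of_int (partial_quotient (Suc k) x)))"
        using pq1[OF x] that by (intro member_le_sum) auto
      also have "\<dots> \<le> H" using x by (simp add: F_def)
      finally have "real_of_int (partial_quotient (Suc k) x) \<le> exp H"
        using pq1[OF x, of k] by (metis exp_le_cancel_iff exp_ln of_int_1_le_iff less_le_trans zero_less_one)
      then show ?thesis using pq1[OF x, of k] by (auto simp: B_def le_floor_iff nat_mono)
    qed
    then have "w \<in> W" unfolding W_def w_def by (intro restrict_PiE_iff[THEN iffD2]) auto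
    moreover have "int (nat (partial_quotient (Suc k) x)) = partial_quotient (Suc k) x" for k
      using pq1[OF x, of k] by simp
    then have "x \<in> U w"
      using x by (simp add: U_def w_def)
    ultimately show "x \<in> (\<Union>w\<in>W. U w)" by blast
  qed
  have lnP: "(\<Sum>k<n. ln (real_of_int (partial_quotient (Suc k) x))) = ln (P w)"
    if "w \<in> W" "x \<in> U w" for x w
  proof -
    have "0 < real (w k)" if "k < n" for k using w_ge[OF \<open>w \<in> W\<close> that] by simp
    then have "ln (P w) = (\<Sum>k<n. ln (real (w k)))"
      unfolding P_def by (intro ln_prod) auto
    then show ?thesis using that(2) by (simp add: U_def)
  qed
  have dist_U: "\<bar>x - y\<bar> \<le> exp (-L) / P w" if w: "w \<in> W" and x: "x \<in> U w" and y: "y \<in> U w" for x y w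
  proof -
    have tail: "0 \<le> (gauss_map ^^ n) z \<and> (gauss_map ^^ n) z \<le> P w * exp (-L)" if z: "z \<in> U w" for z
    proof -
      have zF: "z \<in> F" using z by (simp add: U_def)
      let ?a = "real_of_int (partial_quotient (Suc n) z)"
      have a: "1 \<le> ?a" using pq1[OF zF, of n] by simp
      have "L \<le> ln (P w) + ln ?a"
        using zF lnP[OF w z] by (simp add: F_def)
      also have "\<dots> = ln (P w * ?a)" using a P1[OF w] by (simp add: ln_mult)
      finally have "exp L \<le> P w * ?a" using a P1[OF w] by (subst (asm) ln_ge_iff) auto
      then have "1 / ?a \<le> P w * exp (-L)" using a by (simp add: exp_minus field_simps)
      moreover have "(gauss_map ^^ n) z \<le> 1 / ?a"
      proof -
        have "0 < (gauss_map ^^ Suc n) z" using gauss_tail_irrational F[OF zF] by blast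
        then have "1 / (?a + (gauss_map ^^ Suc n) z) \<le> 1 / ?a"
          using a by (intro divide_left_mono) auto
        then show ?thesis by (simp only: gauss_tail_step[OF F[OF zF], of n, symmetric])
      qed
      moreover have "0 < (gauss_map ^^ n) z" using gauss_tail_irrational F[OF zF] by blast
      ultimately show ?thesis by linarith
    qed
    have xF: "x \<in> F" and yF: "y \<in> F" using x y by (auto simp: U_def)
    have "\<bar>(gauss_map ^^ 0) x - (gauss_map ^^ 0) y\<bar> \<le>
        \<bar>(gauss_map ^^ n) x - (gauss_map ^^ n) y\<bar> / (\<Prod>k<n. (real (w k))^2)"
    proof (rule tails_distance(2))
      show "(gauss_map ^^ k) x = 1 / (real (w k) + (gauss_map ^^ Suc k) x)" if "k < n" for k
      proof -
        have "real (w k) = real_of_int (partial_quotient (Suc k) x)"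
          using x that by (simp add: U_def)
        then show ?thesis by (simp only: gauss_tail_step[OF F[OF xF], of k, symmetric])
      qed
      show "(gauss_map ^^ k) y = 1 / (real (w k) + (gauss_map ^^ Suc k) y)" if "k < n" for k
      proof -
        have "real (w k) = real_of_int (partial_quotient (Suc k) y)"
          using y that by (simp add: U_def)
        then show ?thesis by (simp only: gauss_tail_step[OF F[OF yF], of k, symmetric])
      qed
      show "1 \<le> real (w k)" if "k < n" for k using w_ge[OF w that] by simp
      show "0 \<le> (gauss_map ^^ k) x \<and> (gauss_map ^^ k) x \<le> 1"
        and "0 \<le> (gauss_map ^^ k) y \<and> (gauss_map ^^ k) y \<le> 1" for k
        using gauss_tail_irrational[OF F[OF xF], of k] gauss_tail_irrational[OF F[OF yF], of k] by auto
    qed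
    also have "(\<Prod>k<n. (real (w k))^2) = (P w)^2" by (simp add: P_def prod_power_distrib)
    also have "\<bar>(gauss_map ^^ n) x - (gauss_map ^^ n) y\<bar> / (P w)^2 \<le> (P w * exp (-L)) / (P w)^2"
      using tail[OF x] tail[OF y] by (intro divide_right_mono) auto
    also have "\<dots> = exp (-L) / P w" using P1[OF w] by (simp add: power2_eq_square)
    finally show ?thesis by simp
  qed
  have diam_U: "diameter (U w) \<le> exp (-L) / P w" if "w \<in> W" for w
    using dist_U[OF that] P1[OF that] by (intro diameter_le) auto
  have bounded_U: "bounded (U w)" for w
    by (rule bounded_subset[of "{0..1}"]) (use F in \<open>force simp: U_def\<close>)+
  have "exp (-L) / P w \<le> \<delta>" if "w \<in> W" for w
  proof -
    have "exp (-L) / P w \<le> exp (-L) / 1" using P1[OF that] by (intro divide_left_mono) auto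
    then show ?thesis using assms by simp
  qed
  then have "bounded (U w) \<and> diameter (U w) \<le> \<delta>" if "w \<in> W" for w
    using diam_U[OF that] bounded_U that by (meson order_trans)
  moreover have "0 \<le> \<delta>" using assms(5) exp_gt_zero[of "-L"] by linarith
  ultimately have "hausdorff_content s \<delta> F \<le> (\<Sum>w\<in>W. diameter_power s (U w))"
    by (intro hausdorff_content_finite_cover finW cover)
  also have "\<dots> \<le> (\<Sum>w\<in>W. ennreal ((\<Prod>k<n. real (w k) powr -p) * exp ((p - s) * H - s * L)))"
  proof (rule sum_mono)
    fix w assume w: "w \<in> W"
    show "diameter_power s (U w) \<le> ennreal ((\<Prod>k<n. real (w k) powr -p) * exp ((p - s) * H - s * L))"
    proof (cases "U w = {}")
      case False
      then obtain x where x: "x \<in> U w" by blast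
      have lnH: "ln (P w) \<le> H" using lnP[OF w x] x by (auto simp: U_def F_def)
      have "diameter (U w) powr s \<le> (exp (-L) / P w) powr s"
        using diam_U[OF w] assms bounded_U by (intro powr_mono2 diameter_ge_0) auto
      also have "\<dots> = exp (- p * ln (P w) + ((p - s) * ln (P w) - s * L))"
        using P1[OF w] by (simp add: powr_def ln_div algebra_simps)
      also have "\<dots> \<le> exp (- p * ln (P w) + ((p - s) * H - s * L))"
        using lnH assms by (simp add: mult_left_mono)
      also have "\<dots> = P w powr -p * exp ((p - s) * H - s * L)"
        using P1[OF w] by (simp add: powr_def flip: exp_add)
      also have "P w powr -p = (\<Prod>k<n. real (w k) powr -p)"
        unfolding P_def by (intro prod_powr_distrib)
      finally show ?thesis using False assms(3) by (simp add: diameter_power_def ennreal_leI)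
    qed (simp add: diameter_power_def)
  qed
  also have "\<dots> = ennreal (\<Sum>w\<in>W. (\<Prod>k<n. real (w k) powr -p) * exp ((p - s) * H - s * L))"
    by (intro sum_ennreal mult_nonneg_nonneg prod_nonneg) auto
  also have "\<dots> \<le> ennreal ((\<Sum>a. real a powr -p) ^ n * exp ((p - s) * H - s * L))"
    using sum_digit_words_le[OF assms(2), of n B]
    by (intro ennreal_leI) (simp add: W_def flip: sum_distrib_right)
  finally show ?thesis .
qed

text \<open>
  For small \<open>\<epsilon>\<close> the exponent of the preceding bound, with \<open>p = 1 + \<epsilon>\<close>, \<open>H = (1 + \<epsilon>) \<psi>(n)\<close> and
  \<open>L = (1 - \<epsilon>) \<psi>(n+1)\<close>, is at most \<open>-\<beta> \<psi>(n)\<close> for some \<open>\<beta> > 0\<close> whenever \<open>\<psi>(n+1) > b \<psi>(n)\<close>: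
  at \<open>\<epsilon> = 0\<close> this says \<open>(1 - s) - s b < 0\<close>. The factor \<open>Z\<^sup>n\<close> is absorbed because \<open>\<psi>\<close> grows faster
  than linearly.
\<close>
lemma hausdorff_dim_E_set_le:
  fixes \<psi> :: "nat \<Rightarrow> nat"
  assumes pos: "\<And>n. n \<ge> 1 \<Longrightarrow> \<psi> n \<ge> 1"
    and fast: "filterlim (\<lambda>n. real (\<psi> n) / real n) at_top sequentially"
    and s: "0 < s" "s \<le> 1" "1 < s * (1 + b)"
    and freq: "\<exists>\<^sub>F n in sequentially. b * real (\<psi> n) < real (\<psi> (n + 1))"
  shows "hausdorff_dim (E_set \<psi>) \<le> ennreal s"
proof (rule hausdorff_dim_le)
  show "0 \<le> s" using s by simp
  fix \<delta> :: real assume \<delta>: "\<delta> > 0"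
  define S where "S n x = (\<Sum>k<n. ln (real_of_int (partial_quotient (Suc k) x)))" for n x
  have "((\<lambda>\<epsilon>. s * (1 - \<epsilon>) * b - (1 + \<epsilon> - s) * (1 + \<epsilon>)) \<longlongrightarrow>
      s * (1 - 0) * b - (1 + 0 - s) * (1 + 0)) (at_right 0)"
    by (intro tendsto_intros)
  then have "\<forall>\<^sub>F \<epsilon> in at_right 0. 0 < s * (1 - \<epsilon>) * b - (1 + \<epsilon> - s) * (1 + \<epsilon>)"
    using s(3) by (intro order_tendstoD(1)) (auto simp: algebra_simps)
  moreover have "\<forall>\<^sub>F \<epsilon>::real in at_right 0. \<epsilon> \<in> {0<..<1}"
    by (rule eventually_at_right_real) simp
  ultimately have "\<forall>\<^sub>F \<epsilon> in at_right 0. \<epsilon> \<in> {0<..<1} \<and> 0 < s * (1 - \<epsilon>) * b - (1 + \<epsilon> - s) * (1 + \<epsilon>)"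
    by eventually_elim auto
  then have "\<exists>\<epsilon>. \<epsilon> \<in> {0<..<1} \<and> 0 < s * (1 - \<epsilon>) * b - (1 + \<epsilon> - s) * (1 + \<epsilon>)"
    by (intro eventually_happens'[OF trivial_limit_at_right_real])
  then obtain \<epsilon> where \<epsilon>: "0 < \<epsilon>" "\<epsilon> < 1" "0 < s * (1 - \<epsilon>) * b - (1 + \<epsilon> - s) * (1 + \<epsilon>)"
    by auto
  define \<beta> where "\<beta> = s * (1 - \<epsilon>) * b - (1 + \<epsilon> - s) * (1 + \<epsilon>)"
  have \<beta>: "\<beta> > 0" using \<epsilon> by (simp add: \<beta>_def)
  define Z where "Z = (\<Sum>a. real a powr -(1 + \<epsilon>))"
  have "Z > 0" unfolding Z_def
    using \<epsilon>(1) by (intro suminf_pos2[where i = 1]) (auto simp: summable_real_powr_iff)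
  \<comment> \<open>The index from which the estimates hold depends on the point, whence the countable union.\<close>
  define A where "A N = {x. 0 \<le> x \<and> x < 1 \<and> x \<notin> \<rat> \<and>
      (\<forall>n\<ge>N. (1 - \<epsilon>) * real (\<psi> n) \<le> S n x \<and> S n x \<le> (1 + \<epsilon>) * real (\<psi> n))}" for N
  have "E_set \<psi> \<subseteq> (\<Union>N. A N)"
  proof
    fix x assume x: "x \<in> E_set \<psi>"
    have "(\<lambda>n. S n x / real (\<psi> n)) \<longlonglongrightarrow> 1"
      using x by (simp add: E_set_def S_def sum.atLeast1_atMost_eq)
    then have "\<forall>\<^sub>F n in sequentially. dist (S n x / real (\<psi> n)) 1 < \<epsilon>"
      using \<epsilon>(1) by (rule tendstoD)
    then have "\<forall>\<^sub>F n in sequentially. (1 - \<epsilon>) * real (\<psi> n) \<le> S n x \<and> S n x \<le> (1 + \<epsilon>) * real (\<psi> n)"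
      using eventually_ge_at_top[of 1]
    proof eventually_elim
      case (elim n)
      have "0 < real (\<psi> n)" using pos[OF elim(2)] by simp
      then show ?case using elim(1) by (auto simp: dist_real_def abs_less_iff field_simps)
    qed
    then show "x \<in> (\<Union>N. A N)"
      using x unfolding eventually_sequentially by (auto simp: E_set_def A_def)
  qed
  then have "hausdorff_content s \<delta> (E_set \<psi>) \<le> hausdorff_content s \<delta> (\<Union>N. A N)"
    by (rule hausdorff_content_mono)
  also have "hausdorff_content s \<delta> (\<Union>N. A N) = 0"
  proof (rule hausdorff_content_Union_eq_0)
    fix N
    have "hausdorff_content s \<delta> (A N) \<le> ennreal \<eta>" if \<eta>: "\<eta> > 0" for \<eta> :: real
    proof -
      \<comment> \<open>Growth \<open>\<psi>(n) \<ge> K n\<close> is enough to beat \<open>Z\<^sup>n\<close> with a factor \<open>exp (-n)\<close> to spare, and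
        \<open>K \<ge> 1\<close> makes \<open>exp (-L)\<close> tend to \<open>0\<close>.\<close>
      define K where "K = max ((ln Z + 1) / \<beta>) 1"
      have fastE: "\<forall>\<^sub>F n in sequentially. K \<le> real (\<psi> n) / real n"
        using fast by (auto simp: filterlim_at_top)
      have exp0: "(\<lambda>n. exp (- real n)) \<longlonglongrightarrow> 0"
        using LIMSEQ_realpow_zero[of "exp (-1::real)"] by (simp flip: exp_of_nat_mult)
      have exp1: "(\<lambda>n. exp (- (1 - \<epsilon>) * real n)) \<longlonglongrightarrow> 0"
        using LIMSEQ_realpow_zero[of "exp (- (1 - \<epsilon>))"] \<epsilon>(2)
        by (simp add: mult.commute flip: exp_of_nat_mult)
      have "\<forall>\<^sub>F n in sequentially. N \<le> n \<and> 1 \<le> n \<and> exp (- real n) < \<eta> \<and>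
          exp (- (1 - \<epsilon>) * real (Suc n)) < \<delta> \<and> K \<le> real (\<psi> n) / real n \<and>
          K \<le> real (\<psi> (Suc n)) / real (Suc n)"
        using order_tendstoD(2)[OF exp0 \<eta>] order_tendstoD(2)[OF LIMSEQ_Suc[OF exp1] \<delta>]
          fastE fastE[THEN eventually_sequentially_Suc[THEN iffD2]]
          eventually_ge_at_top[of N] eventually_ge_at_top[of 1]
        by eventually_elim auto
      then obtain n where n: "N \<le> n" "1 \<le> n" "exp (- real n) < \<eta>"
          "exp (- (1 - \<epsilon>) * real (Suc n)) < \<delta>" "K \<le> real (\<psi> n) / real n"
          "K \<le> real (\<psi> (Suc n)) / real (Suc n)" and bn: "b * real (\<psi> n) < real (\<psi> (n + 1))"
        using frequently_ex[OF frequently_eventually_frequently[OF freq]] by blast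
      define H where "H = (1 + \<epsilon>) * real (\<psi> n)"
      define L where "L = (1 - \<epsilon>) * real (\<psi> (Suc n))"
      have "real (Suc n) \<le> real (\<psi> (Suc n))"
      proof -
        have "1 \<le> real (\<psi> (Suc n)) / real (Suc n)" using n(6) by (simp add: K_def)
        then show ?thesis by (simp add: field_simps)
      qed
      then have "(1 - \<epsilon>) * real (Suc n) \<le> L"
        unfolding L_def using \<epsilon>(2) by (intro mult_left_mono) auto
      then have "exp (-L) \<le> exp (- (1 - \<epsilon>) * real (Suc n))"
        by (simp only: exp_le_cancel_iff minus_mult_left neg_le_iff_le)
      then have L\<delta>: "exp (-L) \<le> \<delta>" using n(4) by linarith
      have "A N \<subseteq> {x. 0 \<le> x \<and> x < 1 \<and> x \<notin> \<rat> \<and>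
          (\<Sum>k<n. ln (real_of_int (partial_quotient (Suc k) x))) \<le> H \<and>
          L \<le> (\<Sum>k<Suc n. ln (real_of_int (partial_quotient (Suc k) x)))}"
        using n(1) unfolding A_def S_def H_def L_def by (auto simp del: sum.lessThan_Suc)
      then have "hausdorff_content s \<delta> (A N) \<le> hausdorff_content s \<delta> {x. 0 \<le> x \<and> x < 1 \<and> x \<notin> \<rat> \<and>
          (\<Sum>k<n. ln (real_of_int (partial_quotient (Suc k) x))) \<le> H \<and>
          L \<le> (\<Sum>k<Suc n. ln (real_of_int (partial_quotient (Suc k) x)))}"
        by (rule hausdorff_content_mono)
      also have "\<dots> \<le> ennreal (Z ^ n * exp ((1 + \<epsilon> - s) * H - s * L))"
        unfolding Z_def using s \<epsilon> L\<delta> by (intro hausdorff_content_large_quotient) auto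
      also have "Z ^ n * exp ((1 + \<epsilon> - s) * H - s * L) \<le> \<eta>"
      proof -
        have "s * (1 - \<epsilon>) * (b * real (\<psi> n)) \<le> s * (1 - \<epsilon>) * real (\<psi> (Suc n))"
          using bn s \<epsilon> by (intro mult_left_mono) auto
        then have 1: "(1 + \<epsilon> - s) * H - s * L \<le> - \<beta> * real (\<psi> n)"
          unfolding H_def L_def \<beta>_def by (simp add: algebra_simps)
        have "(ln Z + 1) / \<beta> \<le> real (\<psi> n) / real n" using n(5) by (simp add: K_def)
        then have 2: "real n * (ln Z + 1) \<le> \<beta> * real (\<psi> n)"
          using \<beta> n(2) by (simp add: field_simps)
        have "Z ^ n * exp ((1 + \<epsilon> - s) * H - s * L) = exp (real n * ln Z + ((1 + \<epsilon> - s) * H - s * L))"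
          using \<open>Z > 0\<close> by (simp add: exp_add exp_of_nat_mult)
        also have "\<dots> \<le> exp (- real n)"
          using 1 2 by (simp add: algebra_simps)
        finally show ?thesis using n(3) by linarith
      qed
      finally show ?thesis by (simp add: ennreal_leI)
    qed
    then show "hausdorff_content s \<delta> (A N) = 0"
      by (metis ennreal_le_epsilon add_0 le_zero_eq)
  qed
  finally show "hausdorff_content s \<delta> (E_set \<psi>) = 0" by simp
qed

section \<open>Expansions in varying radices\<close>

text \<open>
  The Cantor series of \<open>t \<in> [0,1)\<close>: the expansion whose digit at position \<open>k\<close> ranges over
  \<open>{0..<r k}\<close>. The tails play the part that the iterates of the Gauss map play for continued
  fractions, so that both expansions can be compared position by position.
\<close>

primrec radix_tail :: "(nat \<Rightarrow> nat) \<Rightarrow> real \<Rightarrow> nat \<Rightarrow> real" where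
  "radix_tail r t 0 = t"
| "radix_tail r t (Suc k) = frac (real (r k) * radix_tail r t k)"

definition radix_digit :: "(nat \<Rightarrow> nat) \<Rightarrow> real \<Rightarrow> nat \<Rightarrow> nat" where
  "radix_digit r t k = nat \<lfloor>real (r k) * radix_tail r t k\<rfloor>"

lemma radix_tail_bounds:
  assumes "0 \<le> t" "t < 1"
  shows "0 \<le> radix_tail r t k \<and> radix_tail r t k < 1"
  using assms by (cases k) (auto simp: frac_lt_1)

lemma radix_digit_less:
  assumes "0 \<le> t" "t < 1" "0 < r k"
  shows "radix_digit r t k < r k"
proof -
  have "real (r k) * radix_tail r t k < real (r k) * 1"
    using radix_tail_bounds[OF assms(1,2), of r k] assms(3) by (intro mult_strict_left_mono) auto
  then have "\<lfloor>real (r k) * radix_tail r t k\<rfloor> < int (r k)"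
    by (simp only: floor_less_iff of_int_of_nat_eq mult_1_right)
  then show ?thesis
    using assms(3) unfolding radix_digit_def by linarith
qed

lemma radix_tail_step:
  assumes "0 \<le> t" "t < 1" "0 < r k"
  shows "radix_tail r t k = (real (radix_digit r t k) + radix_tail r t (Suc k)) / real (r k)"
proof -
  have "0 \<le> real (r k) * radix_tail r t k"
    using radix_tail_bounds[OF assms(1,2), of r k] by simp
  then show ?thesis
    using assms(3) by (simp add: radix_digit_def frac_def)
qed

lemma radix_distance:
  assumes "0 \<le> t" "t < 1" "0 \<le> u" "u < 1" "\<And>k. 0 < r k"
    and "\<And>k. k < n \<Longrightarrow> radix_digit r t k = radix_digit r u k"
  shows "\<bar>t - u\<bar> = \<bar>radix_tail r t n - radix_tail r u n\<bar> / (\<Prod>k<n. real (r k))"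
  using assms(6)
proof (induction n)
  case (Suc n)
  have "radix_tail r t n - radix_tail r u n
      = (radix_tail r t (Suc n) - radix_tail r u (Suc n)) / real (r n)"
    using radix_tail_step[of t r n] radix_tail_step[of u r n] assms Suc.prems[of n]
    by (simp add: diff_divide_distrib add_divide_distrib del: radix_tail.simps)
  then have "\<bar>radix_tail r t n - radix_tail r u n\<bar>
      = \<bar>radix_tail r t (Suc n) - radix_tail r u (Suc n)\<bar> / real (r n)"
    by (simp add: abs_divide del: radix_tail.simps)
  then show ?case using Suc by (simp add: mult.commute del: radix_tail.simps)
qed simp

lemma radix_digits_differ:
  assumes "0 \<le> t" "t < 1" "0 \<le> u" "u < 1" "\<And>k. 2 \<le> r k" "t \<noteq> u"
  shows "\<exists>k. radix_digit r t k \<noteq> radix_digit r u k"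
proof (rule ccontr)
  assume "\<not> ?thesis"
  then have eq: "radix_digit r t k = radix_digit r u k" for k by blast
  have r0: "0 < r k" for k using assms(5)[of k] by simp
  have "\<bar>t - u\<bar> \<le> (1/2)^n" for n
  proof -
    have "(\<Prod>k<n. 2) \<le> (\<Prod>k<n. real (r k))"
      using assms(5) by (intro prod_mono) (auto intro: order_trans[OF _ of_nat_mono, of 2 2])
    then have 1: "2 ^ n \<le> (\<Prod>k<n. real (r k))" by simp
    have "\<bar>t - u\<bar> = \<bar>radix_tail r t n - radix_tail r u n\<bar> / (\<Prod>k<n. real (r k))"
      using assms(1-4) r0 eq by (intro radix_distance)
    also have "\<dots> \<le> 1 / 2 ^ n"
      using 1 radix_tail_bounds[of t r n] radix_tail_bounds[of u r n] assms(1-4)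
      by (intro frac_le) auto
    finally show ?thesis by (simp add: power_one_over)
  qed
  then have "\<bar>t - u\<bar> \<le> 0"
    by (intro LIMSEQ_le_const[OF LIMSEQ_realpow_zero[of "1/2"]]) auto
  then show False using assms(6) by simp
qed

section \<open>The parametrization is inverse Hoelder\<close>

text \<open>
  Let \<open>n\<close> be the first position at which the digits of \<open>t\<close> and \<open>u\<close> differ, by \<open>j\<close> say, and let
  \<open>M\<^sub>n\<close> be the product of the first \<open>n\<close> radices. Then \<open>|t - u|\<close> is at most \<open>2 j / M\<^sub>n\<^sub>+\<^sub>1\<close>, while the
  continued fractions are at least \<open>j / (2 4\<^sup>n\<^sup>+\<^sup>1 M\<^sub>n\<^sub>+\<^sub>1\<^sup>2)\<close> apart. The factor \<open>j\<close> matters: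
  comparing these bounds leaves \<open>j powr (1 - s)\<close>, for which \<open>j \<le> r\<^sub>n = M\<^sub>n\<^sub>+\<^sub>1 / M\<^sub>n\<close> is the worst case,
  and in logarithms this is the growth hypothesis. Ignoring \<open>j\<close> would only give \<open>1/(2b)\<close> in place of
  \<open>1/(1+b)\<close>.
\<close>
lemma cf_radix_hoelder:
  fixes r :: "nat \<Rightarrow> nat" and X :: "real \<Rightarrow> nat \<Rightarrow> real" and s c :: real
  defines "L n \<equiv> ln (\<Prod>k<n. real (r k))"
  assumes r2: "\<And>k. 2 \<le> r k"
    and X_bounds: "\<And>t k. 0 < X t k \<and> X t k \<le> 1/2"
    and X_step: "\<And>t k. X t k = 1 / (real (r k + radix_digit r t k) + X t (Suc k))"
    and s: "0 < s" "s < 1"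
    and growth: "\<And>n. (1 - s) * L n - s * L (Suc n) - s * (real (Suc n) * ln 4) \<ge> - c"
    and t: "0 \<le> t" "t < 1" and u: "0 \<le> u" "u < 1"
  shows "\<bar>t - u\<bar> \<le> exp (2 * ln 2 + c) * \<bar>X t 0 - X u 0\<bar> powr s"
proof (cases "t = u")
  case False
  define M where "M n = (\<Prod>k<n. real (r k))" for n
  have r0: "0 < r k" for k using r2[of k] by simp
  have M0: "0 < M n" for n unfolding M_def using r0 by (intro prod_pos) auto
  have MS: "M (Suc n) = real (r n) * M n" for n by (simp add: M_def mult.commute)
  define n where "n = (LEAST k. radix_digit r t k \<noteq> radix_digit r u k)"
  have neq: "radix_digit r t n \<noteq> radix_digit r u n"
    unfolding n_def by (rule LeastI_ex) (use radix_digits_differ t u r2 False in blast)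
  have eq: "radix_digit r t k = radix_digit r u k" if "k < n" for k
    using that not_less_Least unfolding n_def by blast
  define j where "j = \<bar>real (radix_digit r t n) - real (radix_digit r u n)\<bar>"
  have j1: "1 \<le> j" unfolding j_def using neq by linarith
  have dt: "radix_digit r t k < r k" and du: "radix_digit r u k < r k" for k
    using radix_digit_less t u r0 by auto
  have jr: "j \<le> real (r n)" unfolding j_def using dt[of n] du[of n] by linarith
  have near: "\<bar>t - u\<bar> \<le> 2 * j / M (Suc n)"
  proof -
    have "\<bar>t - u\<bar> = \<bar>radix_tail r t n - radix_tail r u n\<bar> / M n"
      unfolding M_def using t u r0 eq by (intro radix_distance)
    also have "radix_tail r t n - radix_tail r u n =
        (real (radix_digit r t n) - real (radix_digit r u n)
          + (radix_tail r t (Suc n) - radix_tail r u (Suc n))) / real (r n)"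
      using radix_tail_step[OF t, of r n] radix_tail_step[OF u, of r n] r0[of n]
      by (simp add: diff_divide_distrib add_divide_distrib del: radix_tail.simps)
    also have "\<bar>\<dots>\<bar> \<le> 2 * j / real (r n)"
    proof -
      have "\<bar>radix_tail r t (Suc n) - radix_tail r u (Suc n)\<bar> \<le> 1"
        using radix_tail_bounds[OF t, of r "Suc n"] radix_tail_bounds[OF u, of r "Suc n"] by linarith
      then have "\<bar>real (radix_digit r t n) - real (radix_digit r u n)
          + (radix_tail r t (Suc n) - radix_tail r u (Suc n))\<bar> \<le> j + 1"
        unfolding j_def by (intro abs_triangle_ineq[THEN order_trans] add_mono order_refl)
      also have "\<dots> \<le> 2 * j" using j1 by simp
      finally have "\<bar>real (radix_digit r t n) - real (radix_digit r u n)
          + (radix_tail r t (Suc n) - radix_tail r u (Suc n))\<bar> \<le> 2 * j" .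
      then show ?thesis
        unfolding abs_divide by (simp add: divide_right_mono del: radix_tail.simps)
    qed
    finally show ?thesis using M0[of n] by (simp add: MS divide_right_mono field_simps)
  qed
  have far: "j / (2 * 4 ^ Suc n * (M (Suc n))^2) \<le> \<bar>X t 0 - X u 0\<bar>"
  proof -
    define a where "a = real (r n + radix_digit r t n) + X t (Suc n)"
    define b where "b = real (r n + radix_digit r u n) + X u (Suc n)"
    have ab: "1 \<le> a" "a \<le> 2 * real (r n)" "1 \<le> b" "b \<le> 2 * real (r n)"
      using X_bounds[of t "Suc n"] X_bounds[of u "Suc n"] dt[of n] du[of n] r2[of n]
      unfolding a_def b_def by linarith+
    \<comment> \<open>The tails lie in \<open>(0, 1/2]\<close>, so they shift the gap \<open>j \<ge> 1\<close> by at most \<open>1/2\<close>.\<close>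
    have "j = \<bar>(a - b) + (X u (Suc n) - X t (Suc n))\<bar>"
      unfolding j_def a_def b_def of_nat_add by (rule arg_cong[where f = abs]) linarith
    also have "\<dots> \<le> \<bar>a - b\<bar> + \<bar>X u (Suc n) - X t (Suc n)\<bar>" by (rule abs_triangle_ineq)
    also have "\<bar>X u (Suc n) - X t (Suc n)\<bar> \<le> 1/2"
      using X_bounds[of t "Suc n"] X_bounds[of u "Suc n"] by linarith
    finally have "j / 2 \<le> \<bar>a - b\<bar>" using j1 by linarith
    moreover have "a * b \<le> (2 * real (r n)) * (2 * real (r n))"
      using ab by (intro mult_mono) auto
    moreover have "X t n - X u n = (b - a) / (a * b)"
      using X_step[of t n] X_step[of u n] ab by (simp add: a_def b_def diff_frac_eq)
    then have "\<bar>X t n - X u n\<bar> = \<bar>a - b\<bar> / (a * b)"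
      using ab by (simp add: abs_divide abs_minus_commute)
    ultimately have 1: "(j / 2) / ((2 * real (r n)) * (2 * real (r n))) \<le> \<bar>X t n - X u n\<bar>"
      using ab j1 by (simp only:) (intro frac_le mult_pos_pos, auto)
    define w where "w k = real (r k + radix_digit r t k)" for k
    have "\<bar>X t n - X u n\<bar> / (\<Prod>k<n. (w k + 1)^2) \<le> \<bar>X t 0 - X u 0\<bar>"
    proof (rule tails_distance(1))
      show "X t k = 1 / (w k + X t (Suc k))" for k unfolding w_def by (rule X_step)
      show "X u k = 1 / (w k + X u (Suc k))" if "k < n" for k
        unfolding w_def eq[OF that] by (rule X_step)
      show "1 \<le> w k" for k using r2[of k] by (simp add: w_def)
      show "0 \<le> X t k \<and> X t k \<le> 1" "0 \<le> X u k \<and> X u k \<le> 1" for k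
        using X_bounds[of t k] X_bounds[of u k] by auto
    qed
    moreover have "(\<Prod>k<n. (w k + 1)^2) \<le> 4 ^ n * (M n)^2"
    proof -
      have "(\<Prod>k<n. (w k + 1)^2) \<le> (\<Prod>k<n. (2 * real (r k))^2)"
      proof (intro prod_mono conjI power_mono)
        \<comment> \<open>Digits are strictly below \<open>r k\<close>, which makes room for the summand \<open>1\<close>.\<close>
        show "w k + 1 \<le> 2 * real (r k)" for k using dt[of k] unfolding w_def by linarith
      qed (auto simp: w_def)
      also have "\<dots> = 4 ^ n * (M n)^2"
        by (simp add: M_def power_mult_distrib prod.distrib prod_power_distrib)
      finally show ?thesis .
    qed
    moreover have "0 < (\<Prod>k<n. (w k + 1)^2)"
      by (intro prod_pos zero_less_power) (auto simp: w_def intro: add_nonneg_pos)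
    ultimately have "(j / 2) / ((2 * real (r n)) * (2 * real (r n))) / (4 ^ n * (M n)^2) \<le> \<bar>X t 0 - X u 0\<bar>"
      using 1 by (meson frac_le order_trans abs_ge_zero)
    then show ?thesis by (simp add: MS power2_eq_square mult_ac)
  qed
  have lnM: "ln (M n) = L n" "ln (M (Suc n)) = L (Suc n)" by (simp_all add: L_def M_def)
  have jL: "ln j \<le> L (Suc n) - L n"
  proof -
    have "ln j \<le> ln (real (r n))" using j1 jr by simp
    also have "\<dots> = L (Suc n) - L n"
      using M0[of n] r0[of n] unfolding lnM[symmetric] MS by (simp add: ln_mult)
    finally show ?thesis .
  qed
  have exp4: "4 ^ Suc n = exp (real (Suc n) * ln 4)"
    by (simp only: exp_of_nat_mult) simp
  have expM: "M (Suc n) = exp (L (Suc n))" using M0[of "Suc n"] lnM by (metis exp_ln)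
  have expj: "j = exp (ln j)" using j1 by simp
  have "2 * j / M (Suc n) = exp (ln 2 + ln j - L (Suc n))"
    using j1 by (simp add: exp_diff exp_add expM)
  also have "\<dots> \<le> exp (2 * ln 2 + c + s * (ln j - ln 2 - real (Suc n) * ln 4 - 2 * L (Suc n)))"
  proof -
    have "(1 - s) * ln j \<le> (1 - s) * (L (Suc n) - L n)"
      using jL s by (intro mult_left_mono) auto
    moreover have "s * ln 2 \<le> 1 * ln (2::real)"
      using s by (intro mult_right_mono) auto
    ultimately show ?thesis
      using growth[of n] unfolding exp_le_cancel_iff by (simp only: algebra_simps)
  qed
  also have "\<dots> = exp (2 * ln 2 + c) * (j / (2 * 4 ^ Suc n * (M (Suc n))^2)) powr s"
  proof -
    have exp_s: "exp (s * x) = exp x powr s" for x by (simp add: exp_powr_real mult.commute)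
    have "exp (ln j - ln 2 - real (Suc n) * ln 4 - 2 * L (Suc n)) = j / (2 * 4 ^ Suc n * (M (Suc n))^2)"
      unfolding exp4 expM using j1
      by (simp only: exp_diff exp_add exp_double exp_ln) (simp add: divide_simps)
    then show ?thesis by (simp only: exp_add exp_s)
  qed
  also have "\<dots> \<le> exp (2 * ln 2 + c) * \<bar>X t 0 - X u 0\<bar> powr s"
    using far s j1 M0[of "Suc n"] by (intro mult_left_mono powr_mono2) auto
  finally show ?thesis using near by linarith
qed (use s in auto)

section \<open>A Cantor set inside the exceptional set\<close>

lemma fast_imp_ratio_tendsto_0:
  fixes \<psi> :: "nat \<Rightarrow> nat"
  assumes "filterlim (\<lambda>n. real (\<psi> n) / real n) at_top sequentially"
  shows "(\<lambda>n. real n / real (\<psi> n)) \<longlonglongrightarrow> 0" "(\<lambda>n. 1 / real (\<psi> n)) \<longlonglongrightarrow> 0"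
proof -
  show 0: "(\<lambda>n. real n / real (\<psi> n)) \<longlonglongrightarrow> 0"
    using tendsto_inverse_0_at_top[OF assms] by (simp add: inverse_eq_divide)
  show "(\<lambda>n. 1 / real (\<psi> n)) \<longlonglongrightarrow> 0"
  proof (rule tendsto_sandwich[OF _ _ tendsto_const 0])
    show "\<forall>\<^sub>F n in sequentially. 1 / real (\<psi> n) \<le> real n / real (\<psi> n)"
      using eventually_ge_at_top[of 1] by eventually_elim (auto intro!: divide_right_mono)
  qed auto
qed

text \<open>
  The increments of an increasing function equivalent to \<open>\<psi>\<close> are non-negative, so their exponentials
  are at least \<open>1\<close> and are rounded to integers at least \<open>2\<close> at the cost of a factor \<open>3\<close>. The resulting
  error \<open>n ln 3\<close> is negligible against \<open>\<psi>(n)\<close>.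
\<close>
lemma radices_with_log_growth:
  fixes \<psi> :: "nat \<Rightarrow> nat"
  assumes fast: "filterlim (\<lambda>n. real (\<psi> n) / real n) at_top sequentially"
    and "equivalent_to_increasing (\<lambda>n. real (\<psi> n))"
  obtains r where "\<And>k. 2 \<le> r k"
    "(\<lambda>n. ln (\<Prod>k<n. real (r k)) / real (\<psi> n)) \<longlonglongrightarrow> 1"
proof -
  obtain g where g: "mono_on {1..} g" "(\<lambda>n. real (\<psi> n) / g n) \<longlonglongrightarrow> 1"
    using assms(2) by (auto simp: equivalent_to_increasing_def equivalent_seq_def)
  \<comment> \<open>Monotonicity is known from index \<open>1\<close> on; repeating the first value extends it to index \<open>0\<close>.\<close>
  define h where "h n = g (max 1 n)" for n
  have h_mono: "h n \<le> h (Suc n)" for n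
    unfolding h_def by (intro mono_onD[OF g(1)]) auto
  have "(\<lambda>n. inverse (real (\<psi> n) / g n)) \<longlonglongrightarrow> inverse 1"
    using g(2) by (intro tendsto_inverse) auto
  then have "(\<lambda>n. g n / real (\<psi> n)) \<longlonglongrightarrow> 1" by (simp add: inverse_eq_divide)
  moreover have "\<forall>\<^sub>F n in sequentially. g n / real (\<psi> n) = h n / real (\<psi> n)"
    using eventually_ge_at_top[of 1] by eventually_elim (auto simp: h_def max_def)
  ultimately have h_lim: "(\<lambda>n. h n / real (\<psi> n)) \<longlonglongrightarrow> 1"
    by (rule Lim_transform_eventually)
  define r where "r k = 1 + nat \<lceil>exp (h (Suc k) - h k)\<rceil>" for k
  have r: "2 \<le> r k" "exp (h (Suc k) - h k) \<le> real (r k)" "real (r k) \<le> 3 * exp (h (Suc k) - h k)" for k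
  proof -
    have e1: "1 \<le> exp (h (Suc k) - h k)" using h_mono[of k] by simp
    then have "1 \<le> \<lceil>exp (h (Suc k) - h k)\<rceil>" by linarith
    then have "2 \<le> r k" "real (r k) = 1 + real_of_int \<lceil>exp (h (Suc k) - h k)\<rceil>"
      unfolding r_def by linarith+
    then show "2 \<le> r k" "exp (h (Suc k) - h k) \<le> real (r k)" "real (r k) \<le> 3 * exp (h (Suc k) - h k)"
      using e1 by linarith+
  qed
  define L where "L n = ln (\<Prod>k<n. real (r k))" for n
  have L: "h n - h 0 \<le> L n \<and> L n \<le> h n - h 0 + real n * ln 3" for n
  proof -
    have "0 < real (r k)" for k using r(1)[of k] by simp
    then have "L n = (\<Sum>k<n. ln (real (r k)))"
      unfolding L_def by (intro ln_prod) auto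
    moreover have "(\<Sum>k<n. h (Suc k) - h k) \<le> (\<Sum>k<n. ln (real (r k)))"
      using r by (intro sum_mono) (metis exp_gt_zero ln_exp ln_mono less_le_trans)
    moreover have "(\<Sum>k<n. ln (real (r k))) \<le> (\<Sum>k<n. ln 3 + (h (Suc k) - h k))"
    proof (rule sum_mono)
      fix k
      have "ln (real (r k)) \<le> ln (3 * exp (h (Suc k) - h k))"
        using r(1)[of k] r(3)[of k] by (intro ln_mono) auto
      then show "ln (real (r k)) \<le> ln 3 + (h (Suc k) - h k)" by (simp add: ln_mult)
    qed
    ultimately show ?thesis by (simp add: sum_lessThan_telescope sum.distrib)
  qed
  have "(\<lambda>n. L n / real (\<psi> n)) \<longlonglongrightarrow> 1"
  proof (rule tendsto_sandwich)
    show "\<forall>\<^sub>F n in sequentially. (h n - h 0) / real (\<psi> n) \<le> L n / real (\<psi> n)"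
      "\<forall>\<^sub>F n in sequentially. L n / real (\<psi> n) \<le> (h n - h 0 + real n * ln 3) / real (\<psi> n)"
      using L by (auto intro!: always_eventually divide_right_mono)
    note lims = h_lim fast_imp_ratio_tendsto_0[OF fast]
    have "(\<lambda>n. h n / real (\<psi> n) - h 0 * (1 / real (\<psi> n))) \<longlonglongrightarrow> 1 - h 0 * 0"
      by (intro tendsto_intros lims)
    then show "(\<lambda>n. (h n - h 0) / real (\<psi> n)) \<longlonglongrightarrow> 1" by (simp add: diff_divide_distrib)
    have "(\<lambda>n. h n / real (\<psi> n) - h 0 * (1 / real (\<psi> n)) + ln 3 * (real n / real (\<psi> n)))
        \<longlonglongrightarrow> 1 - h 0 * 0 + ln 3 * 0"
      by (intro tendsto_intros lims)
    then show "(\<lambda>n. (h n - h 0 + real n * ln 3) / real (\<psi> n)) \<longlonglongrightarrow> 1"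
      by (simp add: diff_divide_distrib add_divide_distrib mult.commute)
  qed
  then show ?thesis using that r(1) unfolding L_def by blast
qed

text \<open>
  The partial quotients \<open>r\<^sub>k + d\<^sub>k\<close> with digits \<open>d\<^sub>k < r\<^sub>k\<close> lie between \<open>r\<^sub>k\<close> and \<open>2 r\<^sub>k\<close>, so the sum of
  their logarithms differs from that of the radices by at most \<open>n ln 2\<close>.
\<close>
lemma E_set_Cantor_parametrization:
  fixes \<psi> :: "nat \<Rightarrow> nat"
  assumes fast: "filterlim (\<lambda>n. real (\<psi> n) / real n) at_top sequentially"
    and "equivalent_to_increasing (\<lambda>n. real (\<psi> n))"
  obtains r X where "\<And>k. 2 \<le> r k"
    "(\<lambda>n. ln (\<Prod>k<n. real (r k)) / real (\<psi> n)) \<longlonglongrightarrow> 1"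
    "\<And>t k. 0 < X t k \<and> X t k \<le> 1/2"
    "\<And>t k. X t k = 1 / (real (r k + radix_digit r t k) + X t (Suc k))"
    "\<And>t. 0 \<le> t \<Longrightarrow> t < 1 \<Longrightarrow> X t 0 \<in> E_set \<psi>"
proof -
  obtain r where r2: "\<And>k. 2 \<le> r k"
    and r_lim: "(\<lambda>n. ln (\<Prod>k<n. real (r k)) / real (\<psi> n)) \<longlonglongrightarrow> 1"
    using radices_with_log_growth[OF assms] by blast
  have "\<forall>t. \<exists>X. \<forall>k. 0 < X k \<and> X k \<le> 1/2 \<and> X k = 1 / (real (r k + radix_digit r t k) + X (Suc k))"
    using r2 by (intro allI cf_tails_exist) (simp add: trans_le_add1)
  then obtain X where X: "\<And>t k. 0 < X t k \<and> X t k \<le> 1/2"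
    "\<And>t k. X t k = 1 / (real (r k + radix_digit r t k) + X t (Suc k))"
    by metis
  have "X t 0 \<in> E_set \<psi>" if t: "0 \<le> t" "t < 1" for t
  proof -
    have X01: "0 < X t k \<and> X t k < 1" for k using X(1)[of t k] by simp
    note pq = cf_tails_partial_quotients[of "X t" "\<lambda>k. r k + radix_digit r t k", OF X01 X(2)]
    have r0: "0 < real (r k)" for k using r2[of k] by simp
    define S where "S n = (\<Sum>k<n. ln (real (r k + radix_digit r t k)))" for n
    define L where "L n = ln (\<Prod>k<n. real (r k))" for n
    have L_sum: "L n = (\<Sum>k<n. ln (real (r k)))" for n
      unfolding L_def using r0 by (intro ln_prod) auto
    have "L n \<le> S n" for n
      unfolding L_sum S_def using r0 by (intro sum_mono ln_mono) auto
    moreover have "S n \<le> L n + real n * ln 2" for n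
    proof -
      have "S n \<le> (\<Sum>k<n. ln (real (r k)) + ln 2)"
        unfolding S_def
      proof (rule sum_mono)
        fix k
        have "radix_digit r t k < r k" using radix_digit_less t r2[of k] by simp
        then have "ln (real (r k + radix_digit r t k)) \<le> ln (real (r k) * 2)"
          using r0[of k] by (intro ln_mono) auto
        then show "ln (real (r k + radix_digit r t k)) \<le> ln (real (r k)) + ln 2"
          using r0[of k] by (simp add: ln_mult)
      qed
      then show ?thesis by (simp add: L_sum sum.distrib)
    qed
    ultimately have S: "L n \<le> S n \<and> S n \<le> L n + real n * ln 2" for n by blast
    have "(\<lambda>n. S n / real (\<psi> n)) \<longlonglongrightarrow> 1"
    proof (rule tendsto_sandwich)
      show "\<forall>\<^sub>F n in sequentially. L n / real (\<psi> n) \<le> S n / real (\<psi> n)"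
        "\<forall>\<^sub>F n in sequentially. S n / real (\<psi> n) \<le> (L n + real n * ln 2) / real (\<psi> n)"
        using S by (auto intro!: always_eventually divide_right_mono)
      show "(\<lambda>n. L n / real (\<psi> n)) \<longlonglongrightarrow> 1" using r_lim by (simp add: L_def)
      then have "(\<lambda>n. L n / real (\<psi> n) + ln 2 * (real n / real (\<psi> n))) \<longlonglongrightarrow> 1 + ln 2 * 0"
        by (intro tendsto_intros fast_imp_ratio_tendsto_0[OF fast])
      then show "(\<lambda>n. (L n + real n * ln 2) / real (\<psi> n)) \<longlonglongrightarrow> 1"
        by (simp add: add_divide_distrib mult.commute)
    qed
    then show ?thesis
      using pq X01[of 0] by (simp add: E_set_def S_def sum.atLeast1_atMost_eq)
  qed
  then show ?thesis using that r2 r_lim X by blast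
qed

text \<open>
  Divided by \<open>\<psi>(n)\<close>, the left side of the growth hypothesis of \<open>cf_radix_hoelder\<close> is eventually bounded
  below by a sequence with limit \<open>1 - s - s b > 0\<close>.
\<close>
lemma hausdorff_measure_E_set_neq_0:
  fixes \<psi> :: "nat \<Rightarrow> nat"
  assumes pos: "\<And>n. n \<ge> 1 \<Longrightarrow> \<psi> n \<ge> 1"
    and fast: "filterlim (\<lambda>n. real (\<psi> n) / real n) at_top sequentially"
    and incr: "equivalent_to_increasing (\<lambda>n. real (\<psi> n))"
    and s: "0 < s" "0 \<le> b" "s * (1 + b) < 1"
    and ratio: "\<forall>\<^sub>F n in sequentially. real (\<psi> (n + 1)) \<le> b * real (\<psi> n)"
  shows "hausdorff_measure s (E_set \<psi>) \<noteq> 0"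
proof -
  obtain r X where r2: "\<And>k. 2 \<le> r k"
    and r_lim: "(\<lambda>n. ln (\<Prod>k<n. real (r k)) / real (\<psi> n)) \<longlonglongrightarrow> 1"
    and X: "\<And>t k. 0 < X t k \<and> X t k \<le> 1/2"
      "\<And>t k. X t k = 1 / (real (r k + radix_digit r t k) + X t (Suc k))"
    and XE: "\<And>t. 0 \<le> t \<Longrightarrow> t < 1 \<Longrightarrow> X t 0 \<in> E_set \<psi>"
    using E_set_Cantor_parametrization[OF fast incr] by blast
  define L where "L n = ln (\<Prod>k<n. real (r k))" for n
  have L0: "0 \<le> L n" for n
  proof -
    have "1 \<le> real (r k)" for k using r2[of k] by simp
    then show ?thesis unfolding L_def by (intro ln_ge_zero prod_ge_1)
  qed
  have "0 \<le> s * b" using s by simp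
  then have s1: "s < 1" using s(3) by (simp add: algebra_simps)
  define G where "G n = (1 - s) * L n - s * L (Suc n) - s * (real (Suc n) * ln 4)" for n
  have r_lim': "(\<lambda>n. L n / real (\<psi> n)) \<longlonglongrightarrow> 1" using r_lim by (simp add: L_def)
  have "(\<lambda>n. (1 - s) * (L n / real (\<psi> n)) - s * b * (L (Suc n) / real (\<psi> (Suc n)))
      - s * ln 4 * (real n / real (\<psi> n) + 1 / real (\<psi> n))) \<longlonglongrightarrow>
      (1 - s) * 1 - s * b * 1 - s * ln 4 * (0 + 0)"
    by (intro tendsto_intros r_lim' LIMSEQ_Suc[OF r_lim'] fast_imp_ratio_tendsto_0[OF fast])
  moreover have "0 < (1 - s) * 1 - s * b * 1 - s * ln 4 * (0 + 0)"
    using s by (simp add: algebra_simps)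
  ultimately have "\<forall>\<^sub>F n in sequentially. 0 < (1 - s) * (L n / real (\<psi> n))
      - s * b * (L (Suc n) / real (\<psi> (Suc n))) - s * ln 4 * (real n / real (\<psi> n) + 1 / real (\<psi> n))"
    by (rule order_tendstoD(1))
  then have "\<forall>\<^sub>F n in sequentially. 0 \<le> G n"
    using ratio eventually_ge_at_top[of 1]
  proof eventually_elim
    case (elim n)
    define Q where "Q = L (Suc n) / real (\<psi> (Suc n))"
    have p: "0 < real (\<psi> n)" "0 < real (\<psi> (Suc n))" using pos[of n] pos[of "Suc n"] elim(3) by auto
    have "0 \<le> Q" using L0 by (simp add: Q_def)
    then have "Q * real (\<psi> (Suc n)) \<le> Q * (b * real (\<psi> n))"
      using elim(2) by (intro mult_left_mono) auto
    then have "L (Suc n) \<le> Q * b * real (\<psi> n)" using p by (simp add: Q_def)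
    then have 1: "s * L (Suc n) \<le> s * (Q * b * real (\<psi> n))" using s by simp
    have "0 \<le> real (\<psi> n) * ((1 - s) * (L n / real (\<psi> n)) - s * b * Q
        - s * ln 4 * (real n / real (\<psi> n) + 1 / real (\<psi> n)))"
      using elim(1) p unfolding Q_def by (intro mult_nonneg_nonneg) auto
    also have "\<dots> = (1 - s) * L n - s * (Q * b * real (\<psi> n)) - s * (real (Suc n) * ln 4)"
      using p(1) by (simp add: field_simps)
    finally show ?case using 1 unfolding G_def by linarith
  qed
  then obtain N where N: "\<And>n. n \<ge> N \<Longrightarrow> 0 \<le> G n" by (auto simp: eventually_sequentially)
  \<comment> \<open>The finitely many exceptional indices are absorbed into the Hoelder constant.\<close>
  define c where "c = (\<Sum>n<N. \<bar>G n\<bar>)"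
  have growth: "- c \<le> G n" for n
  proof (cases "n < N")
    case True
    then have "\<bar>G n\<bar> \<le> c" unfolding c_def by (intro member_le_sum) auto
    then show ?thesis by linarith
  next
    case False
    moreover have "0 \<le> c" by (simp add: c_def sum_nonneg)
    ultimately show ?thesis using N[of n] by linarith
  qed
  show ?thesis
  proof (rule hausdorff_measure_neq_0_if_expanding[where \<phi> = "\<lambda>t. X t 0" and C = "exp (2 * ln 2 + c)"])
    show "X t 0 \<in> E_set \<psi>" if "t \<in> {0..<1}" for t using that XE by simp
    show "\<bar>t - u\<bar> \<le> exp (2 * ln 2 + c) * dist (X t 0) (X u 0) powr s"
      if "t \<in> {0..<1}" "u \<in> {0..<1}" for t u
      unfolding dist_real_def
      by (rule cf_radix_hoelder[OF r2 X s(1) s1])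
         (use that growth in \<open>auto simp: G_def L_def\<close>)
  qed (use s in auto)
qed

lemma E_set_nonempty: 
  fixes \<psi> :: "nat \<Rightarrow> nat"
  assumes fast: "filterlim (\<lambda>n. real (\<psi> n) / real n) at_top sequentially"
    and "equivalent_to_increasing (\<lambda>n. real (\<psi> n))"
  shows "E_set \<psi> \<noteq> {}"
  using E_set_Cantor_parametrization[OF assms] by (metis empty_iff order_refl zero_less_one)

section \<open>The dimension formula\<close>

lemma equivalent_to_increasing_if_E_set_nonempty:
  fixes \<psi> :: "nat \<Rightarrow> nat"
  assumes "E_set \<psi> \<noteq> {}"
  shows "equivalent_to_increasing (\<lambda>n. real (\<psi> n))"
proof -
  obtain x where x: "0 \<le> x" "x < 1" "x \<notin> \<rat>" and
    lim: "(\<lambda>n. (\<Sum>k=1..n. ln (real_of_int (partial_quotient k x))) / real (\<psi> n)) \<longlonglongrightarrow> 1"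
    using assms by (auto simp: E_set_def)
  define g where "g n = (\<Sum>k=1..n. ln (real_of_int (partial_quotient k x)))" for n
  have "mono_on {1..} g"
  proof (rule mono_onI)
    fix m n :: nat assume "m \<le> n"
    have "0 \<le> ln (real_of_int (partial_quotient k x))" if "k \<in> {1..n}" for k
      using partial_quotient_ge_1[OF x, of "k - 1"] that by simp
    then show "g m \<le> g n"
      unfolding g_def using \<open>m \<le> n\<close> by (intro sum_mono2) auto
  qed
  moreover have "(\<lambda>n. inverse (g n / real (\<psi> n))) \<longlonglongrightarrow> inverse 1"
    using lim unfolding g_def by (intro tendsto_inverse) auto
  then have "(\<lambda>n. real (\<psi> n) / g n) \<longlonglongrightarrow> 1" by simp
  ultimately show ?thesis
    by (auto simp: equivalent_to_increasing_def equivalent_seq_def)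
qed

text \<open>
  Otherwise \<open>\<psi>\<close> would be a strictly decreasing sequence of natural numbers from some index on. The
  bound keeps \<open>1/(1+b)\<close> below \<open>1\<close>, so that only exponents \<open>s \<le> 1\<close> occur in the upper bound.
\<close>
lemma limsup_ratio_ge_1:
  fixes \<psi> :: "nat \<Rightarrow> nat"
  assumes pos: "\<And>n. n \<ge> 1 \<Longrightarrow> \<psi> n \<ge> 1"
  shows "1 \<le> limsup (\<lambda>n. ennreal (real (\<psi> (n + 1)) / real (\<psi> n)))"
proof (rule ccontr)
  assume "\<not> ?thesis"
  then have "\<forall>\<^sub>F n in sequentially. ennreal (real (\<psi> (n + 1)) / real (\<psi> n)) < 1"
    by (intro Limsup_lessD) simp
  then have "\<forall>\<^sub>F n in sequentially. \<psi> (n + 1) < \<psi> n"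
    using eventually_ge_at_top[of 1]
  proof eventually_elim
    case (elim n)
    then have "real (\<psi> (n + 1)) / real (\<psi> n) < 1"
      by (metis ennreal_1 ennreal_less_iff divide_nonneg_nonneg of_nat_0_le_iff)
    then show ?case using pos[OF elim(2)] by (simp add: divide_less_eq)
  qed
  then obtain N where N: "\<And>n. n \<ge> N \<Longrightarrow> \<psi> (n + 1) < \<psi> n"
    by (auto simp: eventually_sequentially)
  have "\<psi> (N + k) + k \<le> \<psi> N" for k
  proof (induction k)
    case (Suc k)
    then show ?case using N[of "N + k"] by simp
  qed simp
  from this[of "Suc (\<psi> N)"] show False by simp
qed

theorem theorem1p1:
  fixes \<psi> :: "nat \<Rightarrow> nat"
  assumes "\<And>n. n \<ge> 1 \<Longrightarrow> \<psi> n \<ge> 1"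
    and "filterlim (\<lambda>n. real (\<psi> n) / real n) at_top sequentially"
  shows "(equivalent_to_increasing (\<lambda>n. real (\<psi> n)) \<longrightarrow>
            E_set \<psi> \<noteq> {} \<and>
            hausdorff_dim (E_set \<psi>) =
              1 / (1 + limsup (\<lambda>n. ennreal (real (\<psi> (n + 1)) / real (\<psi> n)))))
         \<and> (\<not> equivalent_to_increasing (\<lambda>n. real (\<psi> n)) \<longrightarrow> E_set \<psi> = {})"
proof (intro conjI impI)
  show "E_set \<psi> = {}" if "\<not> equivalent_to_increasing (\<lambda>n. real (\<psi> n))"
    using that equivalent_to_increasing_if_E_set_nonempty by blast
next
  assume incr: "equivalent_to_increasing (\<lambda>n. real (\<psi> n))"
  show nonempty: "E_set \<psi> \<noteq> {}" by (rule E_set_nonempty[OF assms(2) incr])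
  define b where "b = limsup (\<lambda>n. ennreal (real (\<psi> (n + 1)) / real (\<psi> n)))"
  have b1: "1 \<le> b" unfolding b_def by (rule limsup_ratio_ge_1[OF assms(1)])
  have inv_b: "1 / (1 + b) = ennreal (1 / (1 + r))" if "b = ennreal r" "0 \<le> r" for r
  proof -
    have "1 + b = ennreal (1 + r)" using that by (metis ennreal_1 ennreal_plus zero_le_one)
    moreover have "ennreal 1 / ennreal (1 + r) = ennreal (1 / (1 + r))"
      using that by (intro divide_ennreal) auto
    ultimately show ?thesis by simp
  qed
  have upper: "hausdorff_dim (E_set \<psi>) \<le> 1 / (1 + b)"
  proof (rule dense_ge_bounded)
    show "1 / (1 + b) < 1"
    proof (cases b)
      case (real r)
      then have "1 \<le> r" using b1 by simp
      then have "ennreal (1 / (1 + r)) < ennreal 1" by (intro ennreal_lessI) auto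
      then show ?thesis using inv_b[OF real(2,1)] by simp
    qed simp
    fix y :: ennreal assume y: "1 / (1 + b) < y" "y < 1"
    then obtain s where s: "y = ennreal s" "0 \<le> s" by (cases y) auto
    have s01: "0 < s" "s < 1"
    proof -
      have "s \<noteq> 0" using y(1) s(1) by auto
      then show "0 < s" using s(2) by simp
      have "ennreal s < ennreal 1" using y(2) s(1) by simp
      then show "s < 1" using s(2) by (simp only: ennreal_less_iff)
    qed
    have "\<exists>b'. 0 \<le> b' \<and> ennreal b' < b \<and> 1 < s * (1 + b')"
    proof (cases b)
      case (real r)
      have "1 / (1 + r) < s" using y(1) inv_b[OF real(2,1)] s real(1) by (simp add: ennreal_less_iff)
      then have "1 / s < 1 + r" using s01 real(1) by (simp add: field_simps)
      then obtain q where q: "1 / s < q" "q < 1 + r" using dense by blast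
      have "1 \<le> 1 / s" using s01 by simp
      moreover have "1 < s * q" using q s01 by (simp add: field_simps)
      ultimately show ?thesis
        using q real by (intro exI[of _ "q - 1"]) (auto simp: ennreal_less_iff)
    next
      case top
      then show ?thesis using s01 by (intro exI[of _ "1 / s"]) (simp add: algebra_simps)
    qed
    then obtain b' where b': "0 \<le> b'" "ennreal b' < b" "1 < s * (1 + b')" by blast
    have "\<exists>\<^sub>F n in sequentially. b' * real (\<psi> n) < real (\<psi> (n + 1))"
    proof (rule ccontr)
      assume "\<not> ?thesis"
      then have "\<forall>\<^sub>F n in sequentially. \<not> b' * real (\<psi> n) < real (\<psi> (n + 1))"
        by (simp add: not_frequently)
      then have "\<forall>\<^sub>F n in sequentially. ennreal (real (\<psi> (n + 1)) / real (\<psi> n)) \<le> ennreal b'"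
        using eventually_ge_at_top[of 1]
      proof eventually_elim
        case (elim n)
        have "0 < real (\<psi> n)" using assms(1)[OF elim(2)] by simp
        then show ?case using elim(1) by (intro ennreal_leI) (simp add: divide_le_eq)
      qed
      then have "b \<le> ennreal b'" unfolding b_def by (rule Limsup_bounded)
      then show False using b'(2) by simp
    qed
    then show "hausdorff_dim (E_set \<psi>) \<le> y"
      unfolding s(1) using assms s01 b' by (intro hausdorff_dim_E_set_le) auto
  qed
  have lower: "1 / (1 + b) \<le> hausdorff_dim (E_set \<psi>)"
    unfolding hausdorff_dim_def
  proof (rule INF_greatest, clarify, rule ccontr)
    fix s :: real
    assume s: "0 \<le> s" "hausdorff_measure s (E_set \<psi>) = 0" and "\<not> 1 / (1 + b) \<le> ennreal s"
    then have less: "ennreal s < 1 / (1 + b)" by simp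
    have s0: "0 < s" using s hausdorff_measure_0_neq_0[OF nonempty] by (cases "s = 0") auto
    have "b \<noteq> top" using less by auto
    then obtain r where r: "b = ennreal r" "0 \<le> r" by (cases b) auto
    have "s < 1 / (1 + r)" using less inv_b[OF r] s(1) by (simp add: ennreal_less_iff)
    then have "1 + r < 1 / s" using s0 r by (simp add: field_simps)
    then obtain q where q: "1 + r < q" "q < 1 / s" using dense by blast
    have "b < ennreal (q - 1)" using q r by (simp add: ennreal_less_iff)
    then have "\<forall>\<^sub>F n in sequentially. ennreal (real (\<psi> (n + 1)) / real (\<psi> n)) < ennreal (q - 1)"
      unfolding b_def by (rule Limsup_lessD)
    then have "\<forall>\<^sub>F n in sequentially. real (\<psi> (n + 1)) \<le> (q - 1) * real (\<psi> n)"
      using eventually_ge_at_top[of 1]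
    proof eventually_elim
      case (elim n)
      have "0 < real (\<psi> n)" using assms(1)[OF elim(2)] by simp
      moreover have "real (\<psi> (n + 1)) / real (\<psi> n) < q - 1"
        using elim(1) by (subst (asm) ennreal_less_iff) auto
      ultimately show ?case by (simp add: divide_less_eq)
    qed
    then have "hausdorff_measure s (E_set \<psi>) \<noteq> 0"
      using assms incr s0 q r by (intro hausdorff_measure_E_set_neq_0[of \<psi> s "q - 1"]) (auto simp: field_simps)
    then show False using s(2) by simp
  qed
  show "hausdorff_dim (E_set \<psi>) =
      1 / (1 + limsup (\<lambda>n. ennreal (real (\<psi> (n + 1)) / real (\<psi> n))))"
    using upper lower unfolding b_def by (rule antisym)
qed
end
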